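(* Let $X$ be a Banach space over the field $\mathbb F$ of real or complex numbers and let $\mathcal A$ be a standard operator subalgebra of $\mathcal B(X)$. Let $\xi\in\mathbb F$ with $\xi\ne0$ and let $L:\mathcal A\to\mathcal B(X)$ be an additive $\xi$-Lie derivation. (1) If $\xi=1$ (that is, $L$ is an additive Lie derivation) and $\dim X\ge3$, then there exist an additive derivation $\tau:\mathcal A\to\mathcal B(X)$ and an additive map $h:\mathcal A\to\mathbb F$ with $h([A,B])=0$ for all $A,B\in\mathcal A$, such that $L(A)=\tau(A)+h(A)I$ for all $A\in\mathcal A$. (2) If $\xi=-1$ (that is, $L$ is an additive Jordan derivation), then $L$ is an additive derivation. (3) If $\xi\ne\pm1$, then $L$ is an additive derivation and $L(\xi A)=\xi L(A)$ for all $A\in\mathcal A$.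
   Context: $\mathcal B(X)$ is the Banach algebra of all bounded linear operators on $X$, with identity $I$. A subalgebra $\mathcal A\subseteq\mathcal B(X)$ is a standard operator algebra if it contains all finite rank operators of $\mathcal B(X)$; it is not required that $\mathcal A$ contain $I$ or be norm closed. For $\xi\in\mathbb F$, $[A,B]_\xi=AB-\xi BA$ and $[A,B]=AB-BA$. An additive map $L:\mathcal A\to\mathcal B(X)$ is an additive $\xi$-Lie derivation if $L([A,B]_\xi)=[L(A),B]_\xi+[A,L(B)]_\xi$ for all $A,B\in\mathcal A$; for $\xi=1$ it is called an additive Lie derivation and for $\xi=-1$ an additive Jordan derivation. An additive map $\tau:\mathcal A\to\mathcal B(X)$ is an additive derivation if $\tau(AB)=\tau(A)B+A\tau(B)$ for all $A,B\in\mathcal A$. (Additive maps are not assumed linear.)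
   Formalization: In (3), when dim X = 1, ξ is additionally assumed to be algebraic over the rationals; for dim X = 1 and transcendental ξ the claim as printed is false (L(a) = D(a) + ca, D an additive derivation of F with D(ξ) ≠ 0, c = −D(ξ)/(1−ξ)). *)

theory Defs
  imports "HOL-Analysis.Analysis" "HOL-Computational_Algebra.Polynomial"
begin

text \<open>The class of scalar fields that are isometric copies of the reals or of the complex numbers;
  it allows the real and the complex case to be treated in a single statement.\<close>

class real_or_complex = real_normed_field +
  assumes real_or_complex:
    "(\<exists>\<phi> :: 'a \<Rightarrow> real. bij \<phi> \<and> (\<forall>a b. \<phi> (a + b) = \<phi> a + \<phi> b) \<and> (\<forall>a b. \<phi> (a * b) = \<phi> a * \<phi> b)
        \<and> (\<forall>r a. \<phi> (r *\<^sub>R a) = r *\<^sub>R \<phi> a) \<and> (\<forall>a. norm (\<phi> a) = norm a)) \<or>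
     (\<exists>\<phi> :: 'a \<Rightarrow> complex. bij \<phi> \<and> (\<forall>a b. \<phi> (a + b) = \<phi> a + \<phi> b) \<and> (\<forall>a b. \<phi> (a * b) = \<phi> a * \<phi> b)
        \<and> (\<forall>r a. \<phi> (r *\<^sub>R a) = r *\<^sub>R \<phi> a) \<and> (\<forall>a. norm (\<phi> a) = norm a))"

instance real :: real_or_complex
  by standard (rule disjI1, rule exI [of _ id], simp)

instance complex :: real_or_complex
  by standard (rule disjI2, rule exI [of _ id], simp)

text \<open>A Banach space over \<open>'k\<close>: the library class \<open>banach\<close> provides a real Banach space, and
  \<open>smul\<close> is the multiplication by scalars from \<open>'k\<close>, compatible with the norm and with the
  real scalar multiplication. Completeness comes from the class.\<close>

locale banach_over = vector_space smul
  for smul :: "'k::real_or_complex \<Rightarrow> 'x::banach \<Rightarrow> 'x" +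
  assumes smul_of_real: "smul (of_real r) x = r *\<^sub>R x"
    and norm_smul: "norm (smul c x) = norm c * norm x"

lemma banach_over_real: "banach_over ((*\<^sub>R) :: real \<Rightarrow> 'x::banach \<Rightarrow> 'x)"
  by unfold_locales (simp_all add: scaleR_add_right scaleR_add_left)

lemma banach_over_complex: "banach_over ((*) :: complex \<Rightarrow> complex \<Rightarrow> complex)"
  by unfold_locales (simp_all add: algebra_simps scaleR_conv_of_real norm_mult)

text \<open>The carrier of $B(X)$. Elements of \<open>'x \<Rightarrow>\<^sub>L 'x\<close> are only real-linear, so linearity over
  \<open>'k\<close> is imposed separately.\<close>

definition bounded_ops :: "('k::real_or_complex \<Rightarrow> 'x::banach \<Rightarrow> 'x) \<Rightarrow> ('x \<Rightarrow>\<^sub>L 'x) set" where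
  "bounded_ops smul = {T. \<forall>c x. blinfun_apply T (smul c x) = smul c (blinfun_apply T x)}"

definition op_scale :: "('k::real_or_complex \<Rightarrow> 'x::banach \<Rightarrow> 'x) \<Rightarrow> 'k \<Rightarrow> ('x \<Rightarrow>\<^sub>L 'x) \<Rightarrow> ('x \<Rightarrow>\<^sub>L 'x)" where
  "op_scale smul c T = Blinfun (\<lambda>x. smul c (blinfun_apply T x))"

lemma (in banach_over) op_scale_apply:
  "blinfun_apply (op_scale smul c T) x = smul c (blinfun_apply T x)"
proof -
  have "bounded_linear (\<lambda>x. smul c (blinfun_apply T x))"
  proof (rule bounded_linear_intro)
    fix x y show "smul c (blinfun_apply T (x + y)) = smul c (blinfun_apply T x) + smul c (blinfun_apply T y)"
      by (simp add: blinfun.add_right scale_right_distrib)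
  next
    fix r x
    have "smul c (r *\<^sub>R y) = r *\<^sub>R smul c y" for y
      by (simp add: smul_of_real [symmetric] mult.commute)
    then show "smul c (blinfun_apply T (r *\<^sub>R x)) = r *\<^sub>R smul c (blinfun_apply T x)"
      by (simp add: blinfun.scaleR_right)
  next
    fix x
    have "norm (blinfun_apply T x) \<le> norm T * norm x"
      by (rule norm_blinfun)
    then show "norm (smul c (blinfun_apply T x)) \<le> norm x * (norm c * norm T)"
      by (simp add: norm_smul mult.assoc mult.left_commute mult.commute mult_left_mono)
  qed
  then show ?thesis
    by (simp add: op_scale_def bounded_linear_Blinfun_apply)
qed

sublocale banach_over \<subseteq> operators: vector_space "op_scale smul"
  by unfold_locales
    (auto intro!: blinfun_eqI simp: op_scale_apply blinfun.add_left scale_right_distrib scale_left_distrib)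

definition finite_rank :: "('k::real_or_complex \<Rightarrow> 'x::banach \<Rightarrow> 'x) \<Rightarrow> ('x \<Rightarrow>\<^sub>L 'x) \<Rightarrow> bool" where
  "finite_rank smul T \<longleftrightarrow> (\<exists>S. finite S \<and> range (blinfun_apply T) \<subseteq> module.span smul S)"

definition standard_operator_algebra ::
    "('k::real_or_complex \<Rightarrow> 'x::banach \<Rightarrow> 'x) \<Rightarrow> ('x \<Rightarrow>\<^sub>L 'x) set \<Rightarrow> bool" where
  "standard_operator_algebra smul \<A> \<longleftrightarrow>
     \<A> \<subseteq> bounded_ops smul \<and>
     module.subspace (op_scale smul) \<A> \<and>
     (\<forall>A\<in>\<A>. \<forall>B\<in>\<A>. A o\<^sub>L B \<in> \<A>) \<and>
     (\<forall>T\<in>bounded_ops smul. finite_rank smul T \<longrightarrow> T \<in> \<A>)"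

text \<open>\<open>vector_space.dim\<close> is \<open>0\<close> on infinite-dimensional spaces, hence the first disjunct.\<close>

definition dim_at_least :: "('k::real_or_complex \<Rightarrow> 'x::banach \<Rightarrow> 'x) \<Rightarrow> nat \<Rightarrow> bool" where
  "dim_at_least smul n \<longleftrightarrow>
     \<not> (\<exists>S. finite S \<and> module.span smul S = UNIV) \<or> n \<le> vector_space.dim smul UNIV"

definition bracket ::
    "('k::real_or_complex \<Rightarrow> 'x::banach \<Rightarrow> 'x) \<Rightarrow> 'k \<Rightarrow> ('x \<Rightarrow>\<^sub>L 'x) \<Rightarrow> ('x \<Rightarrow>\<^sub>L 'x) \<Rightarrow> ('x \<Rightarrow>\<^sub>L 'x)" where
  "bracket smul \<xi> A B = (A o\<^sub>L B) - op_scale smul \<xi> (B o\<^sub>L A)"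

definition commutator :: "('x::banach \<Rightarrow>\<^sub>L 'x) \<Rightarrow> ('x \<Rightarrow>\<^sub>L 'x) \<Rightarrow> ('x \<Rightarrow>\<^sub>L 'x)" where
  "commutator A B = (A o\<^sub>L B) - (B o\<^sub>L A)"

text \<open>Maps defined on \<open>\<A>\<close> are total functions whose values outside \<open>\<A>\<close> are irrelevant.\<close>

definition additive_on :: "'a::ab_group_add set \<Rightarrow> ('a \<Rightarrow> 'b::ab_group_add) \<Rightarrow> bool" where
  "additive_on \<A> f \<longleftrightarrow> (\<forall>A\<in>\<A>. \<forall>B\<in>\<A>. f (A + B) = f A + f B)"

definition additive_xi_Lie_derivation ::
    "('k::real_or_complex \<Rightarrow> 'x::banach \<Rightarrow> 'x) \<Rightarrow> 'k \<Rightarrow> ('x \<Rightarrow>\<^sub>L 'x) set \<Rightarrow>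
      (('x \<Rightarrow>\<^sub>L 'x) \<Rightarrow> ('x \<Rightarrow>\<^sub>L 'x)) \<Rightarrow> bool" where
  "additive_xi_Lie_derivation smul \<xi> \<A> L \<longleftrightarrow>
     L \<in> \<A> \<rightarrow> bounded_ops smul \<and> additive_on \<A> L \<and>
     (\<forall>A\<in>\<A>. \<forall>B\<in>\<A>. L (bracket smul \<xi> A B) = bracket smul \<xi> (L A) B + bracket smul \<xi> A (L B))"

definition additive_derivation ::
    "('k::real_or_complex \<Rightarrow> 'x::banach \<Rightarrow> 'x) \<Rightarrow> ('x \<Rightarrow>\<^sub>L 'x) set \<Rightarrow>
      (('x \<Rightarrow>\<^sub>L 'x) \<Rightarrow> ('x \<Rightarrow>\<^sub>L 'x)) \<Rightarrow> bool" where
  "additive_derivation smul \<A> \<tau> \<longleftrightarrow>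
     \<tau> \<in> \<A> \<rightarrow> bounded_ops smul \<and> additive_on \<A> \<tau> \<and>
     (\<forall>A\<in>\<A>. \<forall>B\<in>\<A>. \<tau> (A o\<^sub>L B) = (\<tau> A o\<^sub>L B) + (A o\<^sub>L \<tau> B))"

text \<open>Remark on the case \<open>\<xi> \<noteq> 1\<close>, \<open>\<xi> \<noteq> - 1\<close>. On a one-dimensional space, where operators
  are identified with scalars, let \<open>D\<close> be an additive derivation of the scalar field with
  \<open>D \<xi> \<noteq> 0\<close>, and put \<open>c = - D \<xi> / (1 - \<xi>)\<close>. Then \<open>L a = D a + c * a\<close> is an additive
  \<open>\<xi>\<close>-Lie derivation, but not a derivation. Such a \<open>D\<close> exists exactly if \<open>\<xi>\<close> is transcendental
  over the rationals, so the theorem assumes in this case that \<open>\<xi>\<close> is \<open>algebraic\<close> if the space is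
  one-dimensional. Since \<open>vector_space.dim\<close> is \<open>0\<close> on infinite-dimensional spaces,
  \<open>vector_space.dim smul UNIV = 1\<close> does say that the dimension is one.\<close>

end

theory Submission
  imports Defs
begin

text \<open>By Hahn-Banach, \<open>\<A>\<close> contains enough rank-one operators to be a prime subring of \<open>B(X)\<close>, also when it
  has no unit.

  For \<open>\<xi> = - 1\<close>, expanding \<open>L (a b x b a + b a x a b)\<close> in two ways gives Bresar's identity
  \<open>\<phi> x [b, a] + [b, a] x \<phi> = 0\<close> for \<open>\<phi> = L (a b) - L a b - a L b\<close>, so that primeness makes \<open>\<phi>\<close> vanish
  when \<open>a\<close> and \<open>b\<close> do not commute; the other pairs follow by additivity.

  For \<open>\<xi> = 1\<close>, let \<open>p\<close> be a rank-one idempotent and \<open>e = 1 - p\<close>. After subtraction of an inner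
  derivation, \<open>L p\<close> is a scalar, hence \<open>L\<close> maps off-diagonal Peirce corners into themselves and
  diagonal ones into themselves up to scalars, which are collected in \<open>h\<close>. For \<open>a = p a e\<close> and
  \<open>b = e b p\<close>, computing \<open>\<tau> (a b a)\<close> in two ways gives \<open>2 h([a, b]) a = 0\<close>.

  For the other \<open>\<xi>\<close>, let \<open>\<kappa> = 1 - \<xi>\<close>. The map \<open>g a = L (\<kappa> a) - \<kappa> L a\<close> satisfies
  \<open>g a b + b g a = a g b + g b a\<close>, which forces \<open>g a = \<kappa> c a\<close> for a scalar \<open>c\<close>. Then \<open>D a = L a - c a\<close> is a
  Jordan derivation, thus a derivation, and the antisymmetric part of the equation for \<open>L\<close> gives
  \<open>c [a, b] = 0\<close>. In dimension one, \<open>D\<close> is a derivation of the field with \<open>D \<xi> = - \<kappa> c\<close>, and it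
  vanishes at algebraic numbers.\<close>

section \<open>Bounded functionals\<close>

definition sublinear :: "('a::real_vector \<Rightarrow> real) \<Rightarrow> bool" where
  "sublinear q \<longleftrightarrow>
     (\<forall>x y. q (x + y) \<le> q x + q y) \<and> (\<forall>t x. 0 \<le> t \<longrightarrow> q (t *\<^sub>R x) = t * q x)"

lemma sublinear_add: "sublinear q \<Longrightarrow> q (x + y) \<le> q x + q y"
  and sublinear_scale: "sublinear q \<Longrightarrow> 0 \<le> t \<Longrightarrow> q (t *\<^sub>R x) = t * q x"
  by (auto simp: sublinear_def)

lemma sublinear_zero: "sublinear q \<Longrightarrow> q 0 = 0"
  using sublinear_scale[of q 0 0] by simp

lemma sublinear_minus_ge: "sublinear q \<Longrightarrow> - q (- x) \<le> q x"
  using sublinear_add[of q x "- x"] sublinear_zero[of q] by simp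

text \<open>A sublinear \<open>q\<close> is linear as soon as \<open>shrink q y = q\<close> for all \<open>y\<close>.\<close>

definition shrink :: "('a::real_vector \<Rightarrow> real) \<Rightarrow> 'a \<Rightarrow> 'a \<Rightarrow> real" where
  "shrink q y x = (INF t\<in>{0..}. q (x + t *\<^sub>R y) - t * q y)"

text \<open>Subadditivity bounds the set below by \<open>- q (- x)\<close>, so that
  \<open>INF\<close> is a true greatest lower bound.\<close>

lemma
  assumes q: "sublinear q"
  shows shrink_le: "0 \<le> t \<Longrightarrow> shrink q y x \<le> q (x + t *\<^sub>R y) - t * q y"
    and shrink_greatest: "(\<And>t. 0 \<le> t \<Longrightarrow> z \<le> q (x + t *\<^sub>R y) - t * q y) \<Longrightarrow> z \<le> shrink q y x"
proof -
  have "- q (- x) \<le> q (x + t *\<^sub>R y) - t * q y" if "0 \<le> t" for t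
    using sublinear_add[OF q, of "x + t *\<^sub>R y" "- x"] sublinear_scale[OF q that, of y] by simp
  then have "bdd_below ((\<lambda>t. q (x + t *\<^sub>R y) - t * q y) ` {0..})"
    by (intro bdd_belowI2[where m = "- q (- x)"]) auto
  then show "0 \<le> t \<Longrightarrow> shrink q y x \<le> q (x + t *\<^sub>R y) - t * q y"
    unfolding shrink_def by (intro cINF_lower) auto
  show "(\<And>t. 0 \<le> t \<Longrightarrow> z \<le> q (x + t *\<^sub>R y) - t * q y) \<Longrightarrow> z \<le> shrink q y x"
    unfolding shrink_def by (intro cINF_greatest) auto
qed

lemma shrink_le_self: "sublinear q \<Longrightarrow> shrink q y x \<le> q x"
  using shrink_le[of q 0 y x] by simp

text \<open>Parameters add: the terms for \<open>x\<close> at \<open>s\<close> and for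
  \<open>x'\<close> at \<open>t\<close> together dominate the term for \<open>x + x'\<close> at
  \<open>s + t\<close>. Scaling the vector by \<open>b\<close> turns the parameter \<open>t\<close>
  into \<open>b * t\<close>.\<close>

lemma sublinear_shrink:
  assumes q: "sublinear q"
  shows "sublinear (shrink q y)"
  unfolding sublinear_def
proof (intro conjI allI impI)
  fix x x'
  have "shrink q y (x + x') - (q (x' + t *\<^sub>R y) - t * q y) \<le> shrink q y x" if t: "0 \<le> t" for t
  proof (rule shrink_greatest[OF q])
    fix s :: real
    assume s: "0 \<le> s"
    have "shrink q y (x + x') \<le> q (x + x' + (s + t) *\<^sub>R y) - (s + t) * q y"
      by (rule shrink_le[OF q]) (use s t in simp)
    moreover have "q (x + x' + (s + t) *\<^sub>R y) \<le> q (x + s *\<^sub>R y) + q (x' + t *\<^sub>R y)"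
      using sublinear_add[OF q, of "x + s *\<^sub>R y" "x' + t *\<^sub>R y"]
      by (simp add: algebra_simps scaleR_add_left)
    ultimately show "shrink q y (x + x') - (q (x' + t *\<^sub>R y) - t * q y) \<le> q (x + s *\<^sub>R y) - s * q y"
      by (simp add: algebra_simps)
  qed
  \<comment> \<open>The infimum over \<open>s\<close> was taken with \<open>t\<close> fixed; now
    comes the one over \<open>t\<close>.\<close>
  then have "shrink q y (x + x') - shrink q y x \<le> shrink q y x'"
    by (intro shrink_greatest[OF q]) (smt (verit))
  then show "shrink q y (x + x') \<le> shrink q y x + shrink q y x'"
    by simp
next
  fix c :: real and x
  assume c: "0 \<le> c"
  have le: "shrink q y (b *\<^sub>R w) \<le> b * shrink q y w" if b: "0 < b" for b w
  proof -
    have "shrink q y (b *\<^sub>R w) / b \<le> shrink q y w"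
    proof (rule shrink_greatest[OF q])
      fix t :: real
      assume t: "0 \<le> t"
      have "shrink q y (b *\<^sub>R w) \<le> q (b *\<^sub>R w + (b * t) *\<^sub>R y) - (b * t) * q y"
        by (rule shrink_le[OF q]) (use t b in simp)
      also have "b *\<^sub>R w + (b * t) *\<^sub>R y = b *\<^sub>R (w + t *\<^sub>R y)"
        by (simp add: scaleR_add_right)
      also have "q \<dots> = b * q (w + t *\<^sub>R y)"
        by (rule sublinear_scale[OF q]) (use b in simp)
      finally show "shrink q y (b *\<^sub>R w) / b \<le> q (w + t *\<^sub>R y) - t * q y"
        using b by (simp add: field_simps)
    qed
    then show ?thesis
      using b by (simp add: field_simps)
  qed
  show "shrink q y (c *\<^sub>R x) = c * shrink q y x"
  proof (cases "c = 0")
    case True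
    have "0 \<le> shrink q y 0"
      by (rule shrink_greatest[OF q]) (simp add: sublinear_scale[OF q])
    moreover have "shrink q y 0 \<le> 0"
      using shrink_le_self[OF q, of y 0] sublinear_zero[OF q] by simp
    ultimately show ?thesis
      using True by simp
  next
    case False
    with c have c: "0 < c" by simp
    \<comment> \<open>The reverse inequality is \<open>le\<close> for the factor
      \<open>inverse c\<close> at the vector \<open>c *\<^sub>R x\<close>.\<close>
    have "c * shrink q y x \<le> shrink q y (c *\<^sub>R x)"
      using le[of "inverse c" "c *\<^sub>R x"] c by (simp add: field_simps)
    with le[OF c, of x] show ?thesis
      by simp
  qed
qed

text \<open>Zorn yields a sublinear \<open>m\<close> that is minimal below \<open>p\<close>. Since
  \<open>shrink m y\<close> is sublinear and below \<open>m\<close>, it equals \<open>m\<close>; at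
  \<open>t = 1\<close> this reads \<open>m x \<le> m (x + y) - m y\<close>, the missing half of
  additivity.\<close>

lemma sublinear_dominates_linear:
  fixes p :: "'a::real_vector \<Rightarrow> real"
  assumes p: "sublinear p"
  obtains u where "linear u" "\<And>x. u x \<le> p x"
proof -
  define S where "S = {q. sublinear q \<and> (\<forall>x. q x \<le> p x)}"
  \<comment> \<open>The order is reversed, so that a maximal element is a pointwise minimal
    functional.\<close>
  define P where "P = (\<lambda>q r :: 'a \<Rightarrow> real. \<forall>x. r x \<le> q x)"
  have "\<exists>m\<in>S. \<forall>a\<in>S. P m a \<longrightarrow> a = m"
  proof (rule predicate_Zorn)
    show "partial_order_on S (relation_of P S)"
      by (rule partial_order_on_relation_ofI) (auto simp: P_def fun_eq_iff intro: order_trans antisym)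
  next
    fix C
    assume C: "C \<in> Chains (relation_of P S)"
    show "\<exists>u\<in>S. \<forall>a\<in>C. P a u"
    proof (cases "C = {}")
      case True
      with p show ?thesis
        by (auto simp: S_def)
    next
      case False
      have CS: "C \<subseteq> S" and total: "P a b \<or> P b a" if "a \<in> C" "b \<in> C" for a b
        using C that by (auto simp: Chains_def relation_of_def)
      have sub: "sublinear q" and le: "q x \<le> p x" if "q \<in> C" for q x
        using CS that by (auto simp: S_def)
      define u where "u x = (INF q\<in>C. q x)" for x
      have "bdd_below ((\<lambda>q. q x) ` C)" for x
      proof (rule bdd_belowI2[where m = "- p (- x)"])
        fix q
        assume q: "q \<in> C"
        show "- p (- x) \<le> q x"
          using le[OF q, of "- x"] sublinear_minus_ge[OF sub[OF q], of x] by simp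
      qed
      then have u_le: "u x \<le> q x" if "q \<in> C" for q x
        unfolding u_def using that by (intro cINF_lower)
      have u_ge: "z \<le> u x" if "\<And>q. q \<in> C \<Longrightarrow> z \<le> q x" for z x
        unfolding u_def using that False by (intro cINF_greatest) auto
      have "sublinear u"
        unfolding sublinear_def
      proof (intro conjI allI impI)
        fix x y
        \<comment> \<open>The smaller of \<open>q\<close> and \<open>r\<close> bounds
          \<open>u (x + y)\<close> by its own subadditivity; this is where \<open>C\<close> being a
          chain enters.\<close>
        have add: "u (x + y) \<le> q x + r y" if "q \<in> C" "r \<in> C" for q r
          using total[OF that]
        proof
          assume "P q r"
          then show ?thesis
            using u_le[OF that(2), of "x + y"] sublinear_add[OF sub[OF that(2)], of x y]
            unfolding P_def by (smt (verit))
        next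
          assume "P r q"
          then show ?thesis
            using u_le[OF that(1), of "x + y"] sublinear_add[OF sub[OF that(1)], of x y]
            unfolding P_def by (smt (verit))
        qed
        have "u (x + y) - r y \<le> u x" if "r \<in> C" for r
          using add that by (intro u_ge) (smt (verit))
        then have "u (x + y) - u x \<le> u y"
          by (intro u_ge) (smt (verit))
        then show "u (x + y) \<le> u x + u y"
          by simp
      next
        fix t :: real and x
        assume t: "0 \<le> t"
        show "u (t *\<^sub>R x) = t * u x"
        proof (cases "t = 0")
          case True
          obtain r where r: "r \<in> C" using False by blast
          have "u 0 \<le> 0"
            using u_le[OF r, of 0] sublinear_zero[OF sub[OF r]] by simp
          moreover have "0 \<le> u 0"
          proof (rule u_ge)
            fix q
            assume "q \<in> C"
            then show "0 \<le> q 0"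
              using sublinear_zero[OF sub, of q] by simp
          qed
          ultimately show ?thesis
            using True by simp
        next
          case False
          with t have t: "0 < t" by simp
          have "u (t *\<^sub>R x) / t \<le> u x"
          proof (rule u_ge)
            fix q
            assume q: "q \<in> C"
            have "u (t *\<^sub>R x) \<le> t * q x"
              using u_le[OF q, of "t *\<^sub>R x"] sublinear_scale[OF sub[OF q], of t x] t by simp
            then show "u (t *\<^sub>R x) / t \<le> q x"
              using t by (simp add: field_simps)
          qed
          moreover have "t * u x \<le> u (t *\<^sub>R x)"
          proof (rule u_ge)
            fix q
            assume q: "q \<in> C"
            show "t * u x \<le> q (t *\<^sub>R x)"
              using u_le[OF q, of x] sublinear_scale[OF sub[OF q], of t x] t by simp
          qed
          ultimately show ?thesis
            using t by (simp add: field_simps)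
        qed
      qed
      moreover have "u x \<le> p x" for x
        using False u_le le by (meson all_not_in_conv order_trans)
      ultimately show ?thesis
        using u_le by (auto simp: S_def P_def)
    qed
  qed
  then obtain m where m: "m \<in> S" and min: "\<And>a. a \<in> S \<Longrightarrow> P m a \<Longrightarrow> a = m"
    by blast
  have sub: "sublinear m" and le: "\<And>x. m x \<le> p x"
    using m by (auto simp: S_def)
  have eq: "shrink m y = m" for y
    using shrink_le_self[OF sub] le
    by (intro min) (auto simp: S_def P_def sublinear_shrink[OF sub] intro: order_trans)
  have add: "m (x + y) = m x + m y" for x y
    using shrink_le[OF sub, of 1 y x] sublinear_add[OF sub, of x y] by (simp add: eq)
  have minus: "m (- x) = - m x" for x
    using add[of x "- x"] sublinear_zero[OF sub] by simp
  have "m (t *\<^sub>R x) = t * m x" for t x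
  proof (cases "0 \<le> t")
    case True
    then show ?thesis
      by (rule sublinear_scale[OF sub])
  next
    case False
    then show ?thesis
      using sublinear_scale[OF sub, of "- t" x] minus[of "t *\<^sub>R x"] by simp
  qed
  then have "linear m"
    by (intro linearI) (auto simp: add)
  then show thesis
    using le by (rule that)
qed

text \<open>Domination by \<open>norm\<close> alone would allow \<open>u = 0\<close>. With
  \<open>shrink norm v\<close>, the choice \<open>t = 1\<close> at \<open>- v\<close> gives
  \<open>u (- v) \<le> - norm v\<close>.\<close>

lemma real_functional_nonzero:
  fixes v :: "'a::real_normed_vector"
  assumes "v \<noteq> 0"
  obtains u :: "'a \<Rightarrow> real" where "bounded_linear u" "u v \<noteq> 0"
proof -
  have norm: "sublinear (norm :: 'a \<Rightarrow> real)"
    by (auto simp: sublinear_def norm_triangle_ineq)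
  obtain u where lin: "linear u" and le: "\<And>x. u x \<le> shrink norm v x"
    using sublinear_dominates_linear[OF sublinear_shrink[OF norm]] by metis
  have minus: "u (- x) = - u x" for x
    using lin by (rule linear_neg)
  have le': "u x \<le> norm x" for x
    using le[of x] shrink_le_self[OF norm, of v x] by simp
  have "bounded_linear u"
  proof (rule bounded_linear_intro)
    show "norm (u x) \<le> norm x * 1" for x
      using le'[of x] le'[of "- x"] by (simp add: minus)
  qed (simp_all add: linear_add[OF lin] linear_cmul[OF lin])
  moreover have "u (- v) \<le> - norm v"
    using le[of "- v"] shrink_le[OF norm, of 1 v "- v"] by simp
  then have "u v \<noteq> 0"
    using assms by (auto simp: minus)
  ultimately show thesis
    by (rule that)
qed

section \<open>Functionals and rank-one operators over the scalar field\<close>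

context banach_over
begin

definition functional :: "('x \<Rightarrow> 'k) \<Rightarrow> bool" where
  "functional f \<longleftrightarrow> bounded_linear f \<and> (\<forall>c x. f (smul c x) = c * f x)"

lemma functional_smul: "functional f \<Longrightarrow> f (smul c x) = c * f x"
  by (simp add: functional_def)

lemma functional_scale: "functional f \<Longrightarrow> functional (\<lambda>x. c * f x)"
  by (auto simp: functional_def bounded_linear_mult_right bounded_linear_compose mult.left_commute)

lemma bounded_linear_smul: "bounded_linear (smul c)"
proof (rule bounded_linear_intro)
  show "smul c (r *\<^sub>R x) = r *\<^sub>R smul c x" for r x
    by (simp add: smul_of_real [symmetric] mult.commute)
  show "norm (smul c x) \<le> norm x * norm c" for x
    by (simp add: norm_smul)
qed (rule scale_right_distrib)

lemma bounded_linear_smul_left: "bounded_linear (\<lambda>c. smul c y)"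
proof (rule bounded_linear_intro)
  show "smul (r *\<^sub>R c) y = r *\<^sub>R smul c y" for r c
    by (simp add: smul_of_real [symmetric] scaleR_conv_of_real)
  show "norm (smul c y) \<le> norm c * norm y" for c
    by (simp add: norm_smul)
qed (rule scale_left_distrib)

text \<open>Over the complex numbers a real functional \<open>u\<close> is turned into the \<open>'k\<close>-linear functional
  \<open>u x - i * u (i * x)\<close>.\<close>

lemma functional_separates:
  assumes "v \<noteq> 0"
  obtains f where "functional f" "f v = 1"
proof -
  obtain u :: "'x \<Rightarrow> real" where u: "bounded_linear u" "u v \<noteq> 0"
    using assms by (metis real_functional_nonzero)
  have "\<exists>f. functional f \<and> f v \<noteq> 0"
    using real_or_complex[where 'a = 'k]
  proof (elim disjE exE conjE)
    fix \<phi> :: "'k \<Rightarrow> real"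
    assume bij: "bij \<phi>" and sc: "\<forall>r a. \<phi> (r *\<^sub>R a) = r *\<^sub>R \<phi> a"
    have inj: "\<phi> a = \<phi> b \<longleftrightarrow> a = b" for a b
      by (rule inj_eq[OF bij_is_inj[OF bij]])
    \<comment> \<open>In the real case every scalar is a real multiple of 1, so real homogeneity of
      \<open>u\<close> is already homogeneity over \<open>'k\<close>.\<close>
    have "\<exists>r. c = of_real r" for c :: 'k
    proof -
      have "\<phi> 1 \<noteq> 0"
      proof
        assume "\<phi> 1 = 0"
        then have "\<phi> 1 = \<phi> (0 *\<^sub>R 1)"
          by (simp only: sc) simp
        then show False
          by (simp add: inj)
      qed
      then have "\<phi> c = \<phi> ((\<phi> c / \<phi> 1) *\<^sub>R 1)"
        by (simp only: sc) simp
      then show ?thesis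
        by (auto simp: inj of_real_def)
    qed
    moreover have "u (smul (of_real r) x) *\<^sub>R (1::'k) = of_real r * (u x *\<^sub>R 1)" for r x
      using linear_cmul[OF bounded_linear.linear[OF u(1)], of r x]
      by (simp add: smul_of_real scaleR_conv_of_real)
    ultimately have "u (smul c x) *\<^sub>R (1::'k) = c * (u x *\<^sub>R 1)" for c x
      by metis
    then have "functional (\<lambda>x. u x *\<^sub>R (1::'k))"
      using u(1) by (auto simp: functional_def intro: bounded_linear_scaleR_const)
    then show ?thesis
      using u(2) by (intro exI[of _ "\<lambda>x. u x *\<^sub>R (1::'k)"]) simp
  next
    fix \<phi> :: "'k \<Rightarrow> complex"
    assume bij: "bij \<phi>" and add: "\<forall>a b. \<phi> (a + b) = \<phi> a + \<phi> b"
      and mult: "\<forall>a b. \<phi> (a * b) = \<phi> a * \<phi> b" and sc: "\<forall>r a. \<phi> (r *\<^sub>R a) = r *\<^sub>R \<phi> a"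
    have inj: "\<phi> a = \<phi> b \<longleftrightarrow> a = b" for a b
      by (rule inj_eq[OF bij_is_inj[OF bij]])
    \<comment> \<open>\<open>j\<close> is the imaginary unit of \<open>'k\<close>, pulled back along
      \<open>\<phi>\<close>.\<close>
    obtain j where j: "\<phi> j = \<i>"
      using bij by (metis bij_pointE)
    obtain w where w: "\<phi> w = 1"
      using bij by (metis bij_pointE)
    have one: "\<phi> 1 = 1"
      using mult[rule_format, of w 1] w by simp
    have of_real: "\<phi> (of_real r) = of_real r" for r
      by (simp add: of_real_def sc one)
    have "\<phi> (j * j) = \<phi> (of_real (- 1))"
      by (simp only: mult of_real j) simp
    then have jj: "j * j = - 1"
      by (simp only: inj) simp
    have c_eq: "c = of_real (Re (\<phi> c)) + j * of_real (Im (\<phi> c))" for c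
    proof -
      have "\<phi> c = \<phi> (of_real (Re (\<phi> c)) + j * of_real (Im (\<phi> c)))"
        by (simp only: add mult of_real j) (rule complex_eq)
      then show ?thesis
        by (simp only: inj)
    qed
    define f where "f x = of_real (u x) - j * of_real (u (smul j x))" for x
    have bl: "bounded_linear (\<lambda>x. u (smul j x))"
      by (rule bounded_linear_compose[OF u(1) bounded_linear_smul])
    have "bounded_linear (\<lambda>x. of_real (u x) :: 'k)"
      unfolding of_real_def using u(1) by (rule bounded_linear_scaleR_const)
    moreover have "bounded_linear (\<lambda>x. j * of_real (u (smul j x)))"
      unfolding of_real_def using bl
      by (intro bounded_linear_compose[OF bounded_linear_mult_right] bounded_linear_scaleR_const)
    ultimately have blf: "bounded_linear f"
      unfolding f_def by (rule bounded_linear_sub)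
    have lin_add: "u (x + y) = u x + u y" and lin_scale: "u (smul (of_real r) x) = r * u x"
      and lin_minus: "u (- x) = - u x" for x y r
      using linear_add[OF bounded_linear.linear[OF u(1)], of x y]
        linear_cmul[OF bounded_linear.linear[OF u(1)], of r x]
        linear_neg[OF bounded_linear.linear[OF u(1)], of x]
      by (simp_all add: smul_of_real)
    have "f (smul c x) = c * f x" for c x
    proof -
      obtain a b where c: "c = of_real a + j * of_real b"
        using c_eq by blast
      have "smul c x = smul (of_real a) x + smul (of_real b) (smul j x)"
        unfolding c by (simp add: scale_left_distrib mult.commute)
      then have 1: "u (smul c x) = a * u x + b * u (smul j x)"
        by (simp only: lin_add lin_scale)
      have "j * c = of_real a * j + of_real b * (j * j)"
        unfolding c by (simp add: algebra_simps)
      then have "smul j (smul c x) = smul (of_real a) (smul j x) + smul (of_real b) (- x)"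
        unfolding jj by (simp add: scale_left_diff_distrib)
      then have 2: "u (smul j (smul c x)) = a * u (smul j x) - b * u x"
        by (simp only: lin_add lin_scale lin_minus mult_minus_right diff_conv_add_uminus)
      have "c * f x = of_real a * of_real (u x) - j * (of_real a * of_real (u (smul j x)))
          + j * (of_real b * of_real (u x)) - j * j * (of_real b * of_real (u (smul j x)))"
        unfolding f_def c by (simp add: algebra_simps)
      then show ?thesis
        unfolding f_def 1 2 jj by (simp add: algebra_simps)
    qed
    with blf have "functional f"
      by (simp add: functional_def)
    \<comment> \<open>The real part of \<open>f\<close> recovers \<open>u\<close>, so
      \<open>f v\<close> is nonzero and can be normalised to 1.\<close>
    moreover have "Re (\<phi> (f v)) = u v"
    proof -
      have "f v = of_real (u v) + j * of_real (- u (smul j v))"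
        by (simp add: f_def)
      then show ?thesis
        by (simp only: add mult of_real j) simp
    qed
    then have "f v \<noteq> 0"
      using u(2) sc[rule_format, of 0 0] by auto
    ultimately show ?thesis
      by blast
  qed
  then obtain f where "functional f" "f v \<noteq> 0"
    by blast
  then show thesis
    by (intro that[of "\<lambda>x. inverse (f v) * f x"]) (auto intro: functional_scale)
qed

text \<open>The operator usually written as y tensor f.\<close>

definition rank_one :: "'x \<Rightarrow> ('x \<Rightarrow> 'k) \<Rightarrow> ('x \<Rightarrow>\<^sub>L 'x)" where
  "rank_one y f = Blinfun (\<lambda>z. smul (f z) y)"

lemma rank_one_apply: "functional f \<Longrightarrow> blinfun_apply (rank_one y f) z = smul (f z) y"
  unfolding rank_one_def
  by (subst bounded_linear_Blinfun_apply)
    (auto simp: functional_def intro: bounded_linear_compose[OF bounded_linear_smul_left])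

end

section \<open>Standard operator algebras\<close>

notation blinfun_compose (infixl "\<odot>" 70)

interpretation compose: bounded_bilinear blinfun_compose
  by (rule bounded_bilinear_blinfun_compose)

lemma compose_assoc: "a \<odot> b \<odot> c = a \<odot> (b \<odot> c)"
  by (rule blinfun_eqI) simp

lemma compose_id [simp]: "id_blinfun \<odot> a = a" "a \<odot> id_blinfun = a"
  by (rule blinfun_eqI, simp)+

lemmas compose_simps = compose.add_left compose.add_right compose.diff_left compose.diff_right
  compose.minus_left compose.minus_right compose_assoc

locale standard_algebra = banach_over smul
  for smul :: "'k::real_or_complex \<Rightarrow> 'x::banach \<Rightarrow> 'x" +
  fixes \<A> :: "('x \<Rightarrow>\<^sub>L 'x) set"
  assumes std: "standard_operator_algebra smul \<A>"
begin

abbreviation sc :: "'k \<Rightarrow> ('x \<Rightarrow>\<^sub>L 'x) \<Rightarrow> ('x \<Rightarrow>\<^sub>L 'x)" where "sc \<equiv> op_scale smul"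
abbreviation \<B> :: "('x \<Rightarrow>\<^sub>L 'x) set" where "\<B> \<equiv> bounded_ops smul"

lemma bounded_opsD: "T \<in> \<B> \<Longrightarrow> T (smul c x) = smul c (T x)"
  by (simp add: bounded_ops_def)

lemma bounded_ops_closed:
  shows "a \<in> \<B> \<Longrightarrow> b \<in> \<B> \<Longrightarrow> a + b \<in> \<B>" "a \<in> \<B> \<Longrightarrow> b \<in> \<B> \<Longrightarrow> a - b \<in> \<B>"
    and "a \<in> \<B> \<Longrightarrow> - a \<in> \<B>" "a \<in> \<B> \<Longrightarrow> b \<in> \<B> \<Longrightarrow> a \<odot> b \<in> \<B>" "a \<in> \<B> \<Longrightarrow> sc c a \<in> \<B>"
    and "id_blinfun \<in> \<B>" "0 \<in> \<B>"
  by (auto simp: bounded_ops_def op_scale_apply blinfun.bilinear_simps scale_right_distrib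
      scale_right_diff_distrib mult.commute)

lemma algebra_bounded: "a \<in> \<A> \<Longrightarrow> a \<in> \<B>"
  using std by (auto simp: standard_operator_algebra_def)

lemma algebra_closed:
  shows "a \<in> \<A> \<Longrightarrow> b \<in> \<A> \<Longrightarrow> a + b \<in> \<A>" "a \<in> \<A> \<Longrightarrow> b \<in> \<A> \<Longrightarrow> a - b \<in> \<A>"
    and "a \<in> \<A> \<Longrightarrow> - a \<in> \<A>" "a \<in> \<A> \<Longrightarrow> b \<in> \<A> \<Longrightarrow> a \<odot> b \<in> \<A>" "a \<in> \<A> \<Longrightarrow> sc c a \<in> \<A>" "0 \<in> \<A>"
  using std unfolding standard_operator_algebra_def
  by (auto intro: operators.subspace_add operators.subspace_diff operators.subspace_neg
      operators.subspace_scale operators.subspace_0)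

lemma rank_one_bounded: "functional f \<Longrightarrow> rank_one y f \<in> \<B>"
  by (auto simp: bounded_ops_def rank_one_apply functional_smul)

lemma rank_one_algebra:
  assumes "functional f"
  shows "rank_one y f \<in> \<A>"
proof -
  have "range (rank_one y f) \<subseteq> span {y}"
    by (auto simp: rank_one_apply[OF assms] span_base span_scale)
  then have "finite_rank smul (rank_one y f)"
    unfolding finite_rank_def by blast
  then show ?thesis
    using std rank_one_bounded[OF assms] by (auto simp: standard_operator_algebra_def)
qed

lemma sc_compose:
  shows sc_compose_left: "sc c a \<odot> b = sc c (a \<odot> b)"
    and sc_compose_right: "a \<in> \<B> \<Longrightarrow> a \<odot> sc c b = sc c (a \<odot> b)"
  by (auto intro!: blinfun_eqI simp: op_scale_apply bounded_opsD)

lemma double_eq_0: "T + T = 0 \<Longrightarrow> T = 0" for T :: "'x \<Rightarrow>\<^sub>L 'x"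
  by (metis scaleR_2 scaleR_eq_0_iff zero_neq_numeral)

section \<open>Primeness and commutation with the algebra\<close>

lemma blinfun_nonzero:
  assumes "T \<noteq> 0"
  obtains z where "blinfun_apply T z \<noteq> 0"
  using assms by (metis blinfun_eqI zero_blinfun.rep_eq)

text \<open>If \<open>f (v z) = 1\<close>, then for \<open>c = rank_one y f\<close> the product
  \<open>u c v\<close> sends \<open>z\<close> to \<open>u y\<close>, and \<open>y\<close> is
  arbitrary.\<close>

lemma prime:
  assumes "\<And>c. c \<in> \<A> \<Longrightarrow> u \<odot> c \<odot> v = 0"
  shows "u = 0 \<or> v = 0"
proof (rule disjCI)
  assume "v \<noteq> 0"
  then obtain z where "v z \<noteq> 0"
    by (rule blinfun_nonzero)
  then obtain f where f: "functional f" "f (v z) = 1"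
    by (rule functional_separates)
  have "u y = 0" for y
    using arg_cong[OF assms[OF rank_one_algebra[OF f(1)], of y], of "\<lambda>T. blinfun_apply T z"] f
    by (simp add: rank_one_apply)
  then show "u = 0"
    by (intro blinfun_eqI) simp
qed

text \<open>The rank-one \<open>c\<close> of \<open>prime\<close> now yields
  \<open>u y = - f (u z) v y\<close>. Taking \<open>y = z\<close> and applying \<open>f\<close>
  turns this into \<open>f (u z) = - f (u z)\<close>, so the coefficient vanishes.\<close>

lemma prime_symmetric:
  assumes v: "v \<in> \<B>" and uv: "\<And>c. c \<in> \<A> \<Longrightarrow> u \<odot> c \<odot> v + v \<odot> c \<odot> u = 0"
  shows "u = 0 \<or> v = 0"
proof (rule disjCI)
  assume "v \<noteq> 0"
  then obtain z where "v z \<noteq> 0"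
    by (rule blinfun_nonzero)
  then obtain f where f: "functional f" "f (v z) = 1"
    by (rule functional_separates)
  have "u y + smul (f (u z)) (v y) = 0" for y
    using arg_cong[OF uv[OF rank_one_algebra[OF f(1)], of y], of "\<lambda>T. blinfun_apply T z"] f
    by (simp add: rank_one_apply blinfun.add_left bounded_opsD[OF v])
  then have u: "u y = smul (- f (u z)) (v y)" for y
    by (simp add: eq_neg_iff_add_eq_0)
  have "f (u z) = - f (u z)"
    using arg_cong[OF u[of z], of f] by (simp only: functional_smul[OF f(1)] f(2) mult_1_right)
  then have "2 * f (u z) = 0"
    by (simp only: mult_2 eq_neg_iff_add_eq_0)
  then have "f (u z) = 0"
    by simp
  then have "u y = 0" for y
    using u[of y] by simp
  then show "u = 0"
    by (intro blinfun_eqI) simp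
qed

text \<open>Comparing both sides for a rank-one \<open>b\<close> at some \<open>z\<close> with
  \<open>f (e z) = 1\<close> gives \<open>s y = f (e (s z)) e y\<close>. It serves for
  \<open>e\<close> the identity and for \<open>e\<close> a Peirce projection.\<close>

lemma commute_scalar:
  assumes "s \<in> \<B>" and e: "e \<in> \<B>" "e \<noteq> 0"
    and comm: "\<And>b. b \<in> \<A> \<Longrightarrow> s \<odot> (e \<odot> b \<odot> e) = e \<odot> b \<odot> e \<odot> s"
    and s: "s \<odot> e = s"
  shows "\<exists>t. s = sc t e"
proof -
  obtain z where "e z \<noteq> 0"
    using e by (metis blinfun_nonzero)
  then obtain f where f: "functional f" "f (e z) = 1"
    by (rule functional_separates)
  have se: "s (e y) = s y" for y
    using arg_cong[OF s, of "\<lambda>T. blinfun_apply T y"] by simp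
  have "s y = sc (f (e (s z))) e y" for y
    using arg_cong[OF comm[OF rank_one_algebra[OF f(1)], of y], of "\<lambda>T. blinfun_apply T z"] f(2)
      bounded_opsD[OF assms(1)] bounded_opsD[OF e(1)]
    by (simp add: rank_one_apply[OF f(1)] op_scale_apply se)
  then show ?thesis
    by (intro exI blinfun_eqI)
qed

end

lemma additive_on_minus:
  assumes "additive_on S f" "0 \<in> S" "a \<in> S" "- a \<in> S"
  shows "f (- a) = - f a"
proof -
  have "f (0 + 0) = f 0 + f 0" "f (a + - a) = f a + f (- a)"
    using assms unfolding additive_on_def by blast+
  then show ?thesis
    by (simp add: eq_neg_iff_add_eq_0 add.commute)
qed

context standard_algebra
begin

lemma double_cancel: "S + S = T + T \<Longrightarrow> S = T" for S T :: "'x \<Rightarrow>\<^sub>L 'x"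
  using double_eq_0[of "S - T"] by (simp add: algebra_simps)

text \<open>Such an \<open>a\<close> is a scalar unless the space is zero. The passage from
  \<open>\<A>\<close> to \<open>\<B>\<close> is made because a derivation of \<open>\<A>\<close>
  takes its values in \<open>\<B>\<close>.\<close>

lemma central_commutes_bounded:
  assumes a: "a \<in> \<B>" and comm: "\<And>b. b \<in> \<A> \<Longrightarrow> a \<odot> b = b \<odot> a" and T: "T \<in> \<B>"
  shows "a \<odot> T = T \<odot> a"
proof (cases "(id_blinfun :: 'x \<Rightarrow>\<^sub>L 'x) = 0")
  case True
  have "S = 0" for S :: "'x \<Rightarrow>\<^sub>L 'x"
    using compose_id(1)[of S] unfolding True by simp
  from this[of "a \<odot> T"] this[of "T \<odot> a"] show ?thesis
    by simp
next
  case False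
  obtain t where "a = sc t id_blinfun"
    using commute_scalar[OF a bounded_ops_closed(6) False] comm by auto
  then show ?thesis
    using T by (simp add: sc_compose)
qed

end

section \<open>Jordan derivations\<close>

context standard_algebra
begin

lemma jordan_derivation_is_derivation:
  assumes D: "\<And>a. a \<in> \<A> \<Longrightarrow> D a \<in> \<B>" and add_on: "additive_on \<A> D"
    and jordan: "\<And>a b. a \<in> \<A> \<Longrightarrow> b \<in> \<A> \<Longrightarrow>
      D (a \<odot> b + b \<odot> a) = D a \<odot> b + a \<odot> D b + D b \<odot> a + b \<odot> D a"
    and a: "a \<in> \<A>" and b: "b \<in> \<A>"
  shows "D (a \<odot> b) = D a \<odot> b + a \<odot> D b"
proof -
  note closed = algebra_closed
  have D_add: "D (a + b) = D a + D b" if "a \<in> \<A>" "b \<in> \<A>" for a b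
    using add_on that by (simp add: additive_on_def)
  have square: "D (a \<odot> a) = D a \<odot> a + a \<odot> D a" if "a \<in> \<A>" for a
    using jordan[OF that that] D_add[OF closed(4)[OF that that] closed(4)[OF that that]]
    by - (rule double_cancel, simp only: ac_simps)
  have triple: "D (a \<odot> b \<odot> a) = D a \<odot> b \<odot> a + a \<odot> D b \<odot> a + a \<odot> b \<odot> D a"
    if "a \<in> \<A>" "b \<in> \<A>" for a b
  proof (rule double_cancel)
    \<comment> \<open>Iterating the Jordan product with \<open>a\<close>:
      \<open>a j + j a = a a b + b a a + 2 a b a\<close>, and the value of \<open>D\<close> is known
      at all terms but the last.\<close>
    let ?j = "a \<odot> b + b \<odot> a"
    have "D (a \<odot> ?j + ?j \<odot> a) =
        D (a \<odot> a \<odot> b + b \<odot> (a \<odot> a)) + (D (a \<odot> b \<odot> a) + D (a \<odot> b \<odot> a))"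
      using that by (simp add: D_add[symmetric] closed) (simp add: compose_simps algebra_simps)
    moreover have "D (a \<odot> ?j + ?j \<odot> a) = D a \<odot> ?j + a \<odot> D ?j + D ?j \<odot> a + ?j \<odot> D a"
      using that by (intro jordan) (auto intro: closed)
    moreover have "D (a \<odot> a \<odot> b + b \<odot> (a \<odot> a)) =
        D (a \<odot> a) \<odot> b + a \<odot> a \<odot> D b + D b \<odot> (a \<odot> a) + b \<odot> D (a \<odot> a)"
      using that by (intro jordan) (auto intro: closed)
    ultimately have "D (a \<odot> b \<odot> a) + D (a \<odot> b \<odot> a) =
        D a \<odot> ?j + a \<odot> D ?j + D ?j \<odot> a + ?j \<odot> D a -
        (D (a \<odot> a) \<odot> b + a \<odot> a \<odot> D b + D b \<odot> (a \<odot> a) + b \<odot> D (a \<odot> a))"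
      by (metis add_diff_cancel_left')
    then show "D (a \<odot> b \<odot> a) + D (a \<odot> b \<odot> a) =
        D a \<odot> b \<odot> a + a \<odot> D b \<odot> a + a \<odot> b \<odot> D a + (D a \<odot> b \<odot> a + a \<odot> D b \<odot> a + a \<odot> b \<odot> D a)"
      unfolding square[OF that(1)] jordan[OF that] by (simp add: compose_simps algebra_simps)
  qed
  have triple': "D (a \<odot> b \<odot> c + c \<odot> b \<odot> a) =
      D a \<odot> b \<odot> c + a \<odot> D b \<odot> c + a \<odot> b \<odot> D c + (D c \<odot> b \<odot> a + c \<odot> D b \<odot> a + c \<odot> b \<odot> D a)"
    if "a \<in> \<A>" "b \<in> \<A>" "c \<in> \<A>" for a b c
  proof -
    \<comment> \<open>Linearisation of \<open>triple\<close>: replace \<open>a\<close> by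
      \<open>a + c\<close> and subtract the two pure terms.\<close>
    have "D ((a + c) \<odot> b \<odot> (a + c)) =
        D (a \<odot> b \<odot> a) + D (c \<odot> b \<odot> c) + D (a \<odot> b \<odot> c + c \<odot> b \<odot> a)"
      using that by (simp add: D_add[symmetric] closed) (simp add: compose_simps algebra_simps)
    then have "D (a \<odot> b \<odot> c + c \<odot> b \<odot> a) =
        D ((a + c) \<odot> b \<odot> (a + c)) - D (a \<odot> b \<odot> a) - D (c \<odot> b \<odot> c)"
      by simp
    then show ?thesis
      using that by (simp add: triple closed D_add) (simp add: compose_simps algebra_simps)
  qed
  define \<phi> where "\<phi> a b = D (a \<odot> b) - D a \<odot> b - a \<odot> D b" for a b
  have \<phi>_add: "\<phi> (a + c) b = \<phi> a b + \<phi> c b" "\<phi> b (a + c) = \<phi> b a + \<phi> b c"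
    if "a \<in> \<A>" "b \<in> \<A>" "c \<in> \<A>" for a b c
    using that unfolding \<phi>_def by (simp_all add: D_add closed compose_simps algebra_simps)
  \<comment> \<open>The Jordan rule says precisely that the defect \<open>\<phi>\<close> of the
    product rule is antisymmetric.\<close>
  have \<phi>_swap: "\<phi> b a = - \<phi> a b" if "a \<in> \<A>" "b \<in> \<A>" for a b
    using jordan[OF that] that unfolding \<phi>_def by (simp add: D_add closed algebra_simps)
  have noncommuting: "\<phi> a b = 0" if ab: "a \<in> \<A>" "b \<in> \<A>" and "a \<odot> b \<noteq> b \<odot> a" for a b
  proof -
    have "\<phi> a b \<odot> x \<odot> (b \<odot> a - a \<odot> b) + (b \<odot> a - a \<odot> b) \<odot> x \<odot> \<phi> a b = 0" if x: "x \<in> \<A>" for x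
    proof -
      \<comment> \<open>On the left, \<open>triple'\<close> applies with outer factors
        \<open>a b\<close> and \<open>b a\<close>; on the right, \<open>triple\<close> is applied
        twice to each nested product. The difference of the expansions involves only
        \<open>\<phi>\<close>.\<close>
      have "D (a \<odot> b \<odot> x \<odot> (b \<odot> a) + b \<odot> a \<odot> x \<odot> (a \<odot> b)) =
          D (a \<odot> (b \<odot> x \<odot> b) \<odot> a) + D (b \<odot> (a \<odot> x \<odot> a) \<odot> b)"
        using ab x by (simp add: D_add closed compose_assoc)
      then have "\<phi> a b \<odot> x \<odot> (b \<odot> a) + a \<odot> b \<odot> x \<odot> \<phi> b a + \<phi> b a \<odot> x \<odot> (a \<odot> b) + b \<odot> a \<odot> x \<odot> \<phi> a b = 0"
        unfolding \<phi>_def using ab x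
        by (simp add: triple' triple closed) (simp add: compose_simps algebra_simps)
      then show ?thesis
        using \<phi>_swap[OF ab] by (simp add: compose_simps algebra_simps)
    qed
    then have "\<phi> a b = 0 \<or> b \<odot> a - a \<odot> b = 0"
      using ab by (intro prime_symmetric) (auto intro: bounded_ops_closed algebra_bounded)
    then show ?thesis
      using that by simp
  qed
  have "\<phi> a b = 0"
  proof (cases "a \<odot> b = b \<odot> a")
    case True
    show ?thesis
    proof (cases "\<forall>c\<in>\<A>. a \<odot> c = c \<odot> a")
      case central_a: True
      show ?thesis
      proof (cases "\<forall>c\<in>\<A>. b \<odot> c = c \<odot> b")
        case central_b: True
        \<comment> \<open>As \<open>D b\<close> and \<open>D a\<close> commute with the central
          \<open>a\<close> and \<open>b\<close>, the Jordan rule is twice the product rule.\<close>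
        have "a \<odot> D b = D b \<odot> a" "b \<odot> D a = D a \<odot> b"
          using central_a central_b
            central_commutes_bounded[OF algebra_bounded[OF a] _ D[OF b]]
            central_commutes_bounded[OF algebra_bounded[OF b] _ D[OF a]] by blast+
        then show ?thesis
          using jordan[OF a b] True a b
          by - (rule double_eq_0, simp add: \<phi>_def D_add closed algebra_simps)
      next
        case False
        \<comment> \<open>Since \<open>a\<close> and \<open>b\<close> commute, \<open>a + c\<close>
          fails to commute with \<open>b\<close> just as \<open>c\<close> does. Thus
          \<open>\<phi>\<close> vanishes at both pairs, and \<open>\<phi> a b\<close> is the
          difference.\<close>
        then obtain c where c: "c \<in> \<A>" "b \<odot> c \<noteq> c \<odot> b" by blast
        then have "\<phi> c b = 0" "\<phi> (a + c) b = 0"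
          using a b True by (auto intro!: noncommuting closed simp: compose_simps)
        then show ?thesis
          using \<phi>_add(1)[OF a b c(1)] by simp
      qed
    next
      case False
      then obtain c where c: "c \<in> \<A>" "a \<odot> c \<noteq> c \<odot> a" by blast
      then have "\<phi> a c = 0" "\<phi> a (b + c) = 0"
        using a b True by (auto intro!: noncommuting closed simp: compose_simps)
      then show ?thesis
        using \<phi>_add(2)[OF b a c(1)] by simp
    qed
  qed (use noncommuting a b in blast)
  then show ?thesis
    by (simp add: \<phi>_def algebra_simps)
qed

end

section \<open>Lie derivations and the Peirce decomposition\<close>

locale peirce = standard_algebra smul \<A>
  for smul :: "'k::real_or_complex \<Rightarrow> 'x::banach \<Rightarrow> 'x" and \<A> +
  fixes p :: "'x \<Rightarrow>\<^sub>L 'x"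
  assumes p: "p \<in> \<A>" "p \<noteq> 0" "p \<noteq> id_blinfun" and idem: "p \<odot> p = p"
begin

text \<open>Booleans index the two Peirce projections, so negation is passage to the complement.
  \<open>E False\<close> need not lie in \<open>\<A>\<close>, but by \<open>E_compose\<close> its
  products with elements of \<open>\<A>\<close> do.\<close>

definition E :: "bool \<Rightarrow> ('x \<Rightarrow>\<^sub>L 'x)" where
  "E i = (if i then p else id_blinfun - p)"

definition corner :: "bool \<Rightarrow> bool \<Rightarrow> ('x \<Rightarrow>\<^sub>L 'x) \<Rightarrow> bool" where
  "corner i j T \<longleftrightarrow> E i \<odot> T = T \<and> T \<odot> E j = T"

lemma idem': "p \<odot> (p \<odot> T) = p \<odot> T"
  by (simp add: idem flip: compose_assoc)

lemma E_idem: "E i \<odot> E i = E i"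
  and E_orth: "i \<noteq> j \<Longrightarrow> E i \<odot> E j = 0"
  and E_nonzero: "E i \<noteq> 0"
  and E_bounded: "E i \<in> \<B>"
  and E_compose: "a \<in> \<A> \<Longrightarrow> E i \<odot> a \<in> \<A>" "a \<in> \<A> \<Longrightarrow> a \<odot> E i \<in> \<A>"
  using p by (auto simp: E_def idem compose_simps
      intro: algebra_closed bounded_ops_closed algebra_bounded)

lemma E_idem': "E i \<odot> (E i \<odot> T) = E i \<odot> T"
  by (simp add: E_idem flip: compose_assoc)

lemma E_sum: "E i + E (\<not> i) = id_blinfun"
  by (simp add: E_def)

lemma E_orth': "i \<noteq> j \<Longrightarrow> E i \<odot> (E j \<odot> T) = 0"
  by (simp add: E_orth flip: compose_assoc)

lemma corner_compress: "corner i j (E i \<odot> T \<odot> E j)"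
  by (simp add: corner_def compose_assoc E_idem E_idem')

lemma corner_mult: "corner i j a \<Longrightarrow> corner j' l b \<Longrightarrow> corner i l (a \<odot> b)"
  unfolding corner_def by (metis compose_assoc)

lemma corner_orth:
  assumes "corner i j a" "corner k l b" "j \<noteq> k"
  shows "a \<odot> b = 0"
proof -
  have "a \<odot> b = a \<odot> (E j \<odot> (E k \<odot> b))"
    using assms(1,2) unfolding corner_def by (metis compose_assoc)
  then show ?thesis
    using assms(3) by (simp add: E_orth')
qed

lemma corner_E: "corner i j a \<Longrightarrow> E k \<odot> a = (if k = i then a else 0)"
  "corner i j a \<Longrightarrow> a \<odot> E l = (if l = j then a else 0)"
  using corner_orth[of k k "E k" i j a] corner_orth[of i j a l l "E l"]
  by (auto simp: corner_def E_idem)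

text \<open>An element of \<open>\<A>\<close> is the sum of its four corners, all of which lie in
  \<open>\<A>\<close>.\<close>

lemma additive_on_corners:
  assumes add: "additive_on \<A> f"
    and zero: "\<And>i j a. a \<in> \<A> \<Longrightarrow> corner i j a \<Longrightarrow> f a = 0"
    and a: "a \<in> \<A>"
  shows "f a = 0"
proof -
  let ?c = "\<lambda>i j. E i \<odot> a \<odot> E j"
  have c: "?c i j \<in> \<A>" "f (?c i j) = 0" for i j
    using a zero[OF _ corner_compress] E_compose by auto
  have "a = (E True + E (\<not> True)) \<odot> a \<odot> (E True + E (\<not> True))"
    by (simp only: E_sum compose_id)
  then have "a = ?c True True + ?c True False + (?c False True + ?c False False)"
    by (simp add: compose_simps ac_simps)
  moreover have "f \<dots> = 0"
    using add c by (simp add: additive_on_def algebra_closed)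
  ultimately show ?thesis
    by simp
qed

text \<open>Compressing an arbitrary \<open>c\<close> to the corner reduces this to
  \<open>prime\<close> for \<open>u \<odot> E j\<close> and the nonzero \<open>E m\<close>.\<close>

lemma prime_corner:
  assumes "\<And>c. c \<in> \<A> \<Longrightarrow> corner j m c \<Longrightarrow> u \<odot> c = 0"
  shows "u \<odot> E j = 0"
proof -
  have "u \<odot> E j \<odot> c \<odot> E m = 0" if "c \<in> \<A>" for c
    using assms[OF _ corner_compress] that E_compose by (simp add: compose_assoc)
  then show ?thesis
    using prime E_nonzero by blast
qed

text \<open>As \<open>L p\<close> commutes with \<open>\<A>\<close>,
  \<open>L [p, a] = [p, L a]\<close>. The off-diagonal corners are the eigenspaces of
  \<open>[p, _]\<close> for 1 and -1, and the diagonal part is its kernel; so \<open>L\<close>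
  preserves both off-diagonal corners and keeps diagonal elements diagonal.\<close>

lemma lie_derivation_decompose_normalized:
  assumes L: "\<And>a. a \<in> \<A> \<Longrightarrow> L a \<in> \<B>" and add_on: "additive_on \<A> L"
    and lie: "\<And>a b. a \<in> \<A> \<Longrightarrow> b \<in> \<A> \<Longrightarrow>
      L (a \<odot> b - b \<odot> a) = L a \<odot> b - b \<odot> L a + (a \<odot> L b - L b \<odot> a)"
    and Lp: "\<And>a. a \<in> \<A> \<Longrightarrow> L p \<odot> a = a \<odot> L p"
  shows "\<exists>\<tau> h. (\<forall>a\<in>\<A>. \<tau> a \<in> \<B>) \<and> additive_on \<A> \<tau> \<and> additive_on \<A> h \<and>
    (\<forall>a\<in>\<A>. \<forall>b\<in>\<A>. \<tau> (a \<odot> b) = \<tau> a \<odot> b + a \<odot> \<tau> b) \<and> (\<forall>a\<in>\<A>. L a = \<tau> a + sc (h a) id_blinfun)"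
proof -
  note closed = algebra_closed
  have L_add: "L (a + b) = L a + L b" if "a \<in> \<A>" "b \<in> \<A>" for a b
    using add_on that by (simp add: additive_on_def)
  have L_0: "L 0 = 0"
    using L_add[of 0 0] closed by simp
  have L_minus: "L (- a) = - L a" if "a \<in> \<A>" for a
    using that closed by (intro additive_on_minus[OF add_on])
  have Lp_comm: "L (p \<odot> a - a \<odot> p) = p \<odot> L a - L a \<odot> p" if "a \<in> \<A>" for a
    using lie[OF p(1) that] Lp[OF that] by simp
  have L_off: "corner i j (L a)" if a: "a \<in> \<A>" and c: "corner i j a" and "i \<noteq> j" for i j a
  proof (cases i)
    case True
    have "p \<odot> a - a \<odot> p = a"
      using corner_E[OF c, of True] True \<open>i \<noteq> j\<close> by (simp add: E_def)
    then have eq: "L a = p \<odot> L a - L a \<odot> p"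
      using Lp_comm[OF a] by simp
    \<comment> \<open>Multiplying by \<open>p\<close> on the left gives
      \<open>p (L a) p = 0\<close>, and then on the right \<open>2 (L a) p = 0\<close>.\<close>
    then have "p \<odot> L a = p \<odot> (p \<odot> L a - L a \<odot> p)" "L a \<odot> p = (p \<odot> L a - L a \<odot> p) \<odot> p"
      by simp_all
    then have "p \<odot> (L a \<odot> p) = 0" "L a \<odot> p = p \<odot> (L a \<odot> p) - L a \<odot> p"
      by (simp_all add: compose_simps idem idem')
    then have "L a \<odot> p = 0"
      by (metis double_eq_0 eq_diff_eq)
    with eq True \<open>i \<noteq> j\<close> show ?thesis
      by (simp add: corner_def E_def compose_simps)
  next
    case False
    have "p \<odot> a - a \<odot> p = - a"
      using corner_E[OF c, of True] False \<open>i \<noteq> j\<close> by (simp add: E_def)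
    then have eq: "L a = L a \<odot> p - p \<odot> L a"
      using Lp_comm[OF a] L_minus[OF a] by (metis minus_diff_eq minus_minus)
    then have "p \<odot> L a = p \<odot> (L a \<odot> p - p \<odot> L a)" "L a \<odot> p = (L a \<odot> p - p \<odot> L a) \<odot> p"
      by simp_all
    then have "p \<odot> (L a \<odot> p) = 0" "p \<odot> L a = p \<odot> (L a \<odot> p) - p \<odot> L a"
      by (simp_all add: compose_simps idem idem')
    then have "p \<odot> L a = 0"
      by (metis double_eq_0 eq_diff_eq)
    with eq False \<open>i \<noteq> j\<close> show ?thesis
      by (simp add: corner_def E_def compose_simps)
  qed
  have L_diag_off: "E (\<not> k) \<odot> L a \<odot> E k = 0" if a: "a \<in> \<A>" and c: "corner i i a" for i k a
  proof -
    have "p \<odot> a - a \<odot> p = 0"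
      using corner_E[OF c, of True] by (simp add: E_def)
    then have "p \<odot> L a = L a \<odot> p"
      using Lp_comm[OF a] L_0 by simp
    then have "L a \<odot> E k = E k \<odot> L a"
      by (simp add: E_def compose_simps)
    then show ?thesis
      by (simp add: compose_assoc E_orth')
  qed
  \<comment> \<open>\<open>a\<close> annihilates the opposite corner on both sides. Compressing
    \<open>L [a, b] = 0\<close> to that corner, for \<open>b\<close> in it, removes the terms with
    \<open>L b\<close>, so the compression of \<open>L a\<close> commutes with the corner.\<close>
  have L_diag: "\<exists>t. E (\<not> i) \<odot> L a \<odot> E (\<not> i) = sc t (E (\<not> i))" if a: "a \<in> \<A>" and c: "corner i i a" for i a
  proof (rule commute_scalar)
    fix b
    assume b: "b \<in> \<A>"
    let ?e = "E (\<not> i)"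
    let ?b = "?e \<odot> b \<odot> ?e"
    have b': "?b \<in> \<A>" using b E_compose by simp
    have ea: "?e \<odot> a = 0" "a \<odot> ?e = 0"
      using corner_E[OF c] by simp_all
    then have "a \<odot> ?b = 0" "?b \<odot> a = 0"
      using corner_orth[OF c corner_compress] corner_orth[OF corner_compress c] by simp_all
    then have "0 = ?e \<odot> (L a \<odot> ?b - ?b \<odot> L a + (a \<odot> L ?b - L ?b \<odot> a)) \<odot> ?e"
      using lie[OF a b'] L_0 by simp
    also have "\<dots> = ?e \<odot> L a \<odot> ?b \<odot> ?e - ?e \<odot> ?b \<odot> L a \<odot> ?e
        + (?e \<odot> a \<odot> L ?b \<odot> ?e - ?e \<odot> L ?b \<odot> (a \<odot> ?e))"
      by (simp add: compose_simps)
    finally show "?e \<odot> L a \<odot> ?e \<odot> (?e \<odot> b \<odot> ?e) = ?e \<odot> b \<odot> ?e \<odot> (?e \<odot> L a \<odot> ?e)"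
      by (simp add: ea compose_assoc E_idem E_idem')
  qed (use a in \<open>auto simp: E_nonzero compose_assoc E_idem intro: bounded_ops_closed(4) E_bounded L\<close>)
  \<comment> \<open>The scalar is unique because \<open>E (\<not> i)\<close> is nonzero, and this
    uniqueness makes \<open>H i\<close> additive.\<close>
  define H where "H i a = (SOME t. E (\<not> i) \<odot> L (E i \<odot> a \<odot> E i) \<odot> E (\<not> i) = sc t (E (\<not> i)))" for i a
  have H: "E (\<not> i) \<odot> L (E i \<odot> a \<odot> E i) \<odot> E (\<not> i) = sc (H i a) (E (\<not> i))" if "a \<in> \<A>" for i a
    unfolding H_def by (rule someI_ex, rule L_diag) (use that E_compose corner_compress in auto)
  have sc_E: "sc s (E i) = sc t (E i) \<longleftrightarrow> s = t" for s t i
    using E_nonzero by simp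
  have H_add: "H i (a + b) = H i a + H i b" if "a \<in> \<A>" "b \<in> \<A>" for i a b
  proof -
    have "sc (H i (a + b)) (E (\<not> i)) = sc (H i a + H i b) (E (\<not> i))"
      using that E_compose
      by (simp add: H[symmetric] closed operators.scale_left_distrib compose.add_left compose.add_right L_add)
    then show ?thesis
      by (simp only: sc_E)
  qed
  have H_0: "H i a = 0" if "a \<in> \<A>" "E i \<odot> a \<odot> E i = 0" for i a
    using H[OF that(1), of i] that(2) L_0 E_nonzero by simp
  \<comment> \<open>On a diagonal corner only one of the two summands survives, and off the diagonal
    none.\<close>
  define h where "h a = H True a + H False a" for a
  have h_add: "h (a + b) = h a + h b" if "a \<in> \<A>" "b \<in> \<A>" for a b
    using that by (simp add: h_def H_add)
  have h_0: "h 0 = 0"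
    using h_add[of 0 0] closed by simp
  have h_minus: "h (- a) = - h a" if "a \<in> \<A>" for a
    using that closed h_add by (intro additive_on_minus[of \<A>]) (auto simp: additive_on_def)
  have h_off: "h a = 0" if "a \<in> \<A>" "corner i j a" "i \<noteq> j" for a i j
    using that corner_E[OF that(2)] unfolding h_def by (simp add: H_0 compose_assoc)
  have h_diag: "h a = H i a" if "a \<in> \<A>" "corner i i a" for a i
    using that corner_E[OF that(2)] unfolding h_def by (cases i) (simp_all add: H_0 compose_assoc)
  define \<tau> where "\<tau> a = L a - sc (h a) id_blinfun" for a
  have \<tau>_add: "\<tau> (a + b) = \<tau> a + \<tau> b" if "a \<in> \<A>" "b \<in> \<A>" for a b
    using that by (simp add: \<tau>_def L_add h_add operators.scale_left_distrib)
  have \<tau>_bounded: "\<tau> a \<in> \<B>" if "a \<in> \<A>" for a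
    using that by (auto simp: \<tau>_def intro: bounded_ops_closed L)
  have \<tau>_0: "\<tau> 0 = 0"
    by (simp add: \<tau>_def L_0 h_0)
  have \<tau>_minus: "\<tau> (- a) = - \<tau> a" if "a \<in> \<A>" for a
    using that by (simp add: \<tau>_def L_minus h_minus)
  have \<tau>_corner: "corner i j (\<tau> a)" if a: "a \<in> \<A>" and c: "corner i j a" for i j a
  proof (cases "i = j")
    case True
    let ?e = "E (\<not> i)"
    have c': "corner i i a" using c True by simp
    have "L a = (E i + ?e) \<odot> L a \<odot> (E i + ?e)"
      by (simp add: E_sum)
    also have "\<dots> = E i \<odot> L a \<odot> E i + ?e \<odot> L a \<odot> ?e"
      using L_diag_off[OF a c', of i] L_diag_off[OF a c', of "\<not> i"]
      by (simp add: compose.add_left compose.add_right)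
    also have "?e \<odot> L a \<odot> ?e = sc (h a) ?e"
      using H[OF a, of i] c' by (simp add: h_diag[OF a c'] corner_def compose_assoc)
    \<comment> \<open>Subtracting \<open>h a\<close> times the identity clears the opposite corner;
      in the corner of \<open>a\<close> it only adds a multiple of \<open>E i\<close>.\<close>
    finally have "\<tau> a = E i \<odot> L a \<odot> E i + sc (h a) ?e - sc (h a) (E i + ?e)"
      by (simp add: \<tau>_def E_sum)
    then have "\<tau> a = E i \<odot> L a \<odot> E i - sc (h a) (E i)"
      by (simp add: operators.scale_right_distrib)
    then show ?thesis
      using True by (simp add: corner_def compose_simps sc_compose E_bounded E_idem E_idem')
  next
    case False
    then show ?thesis
      using L_off[OF a c] h_off[OF a c] by (simp add: \<tau>_def)
  qed
  \<comment> \<open>The scalar parts of \<open>L a\<close> and \<open>L b\<close> drop out of the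
    commutators, so \<open>h\<close> remains only at \<open>[a, b]\<close>.\<close>
  have \<tau>_lie: "\<tau> (a \<odot> b - b \<odot> a) + sc (h (a \<odot> b - b \<odot> a)) id_blinfun =
      \<tau> a \<odot> b - b \<odot> \<tau> a + (a \<odot> \<tau> b - \<tau> b \<odot> a)" if "a \<in> \<A>" "b \<in> \<A>" for a b
    using lie[OF that] that
    by (simp add: \<tau>_def compose_simps sc_compose algebra_bounded)
  \<comment> \<open>For \<open>i \<noteq> l\<close> all products in the reversed order vanish and
    \<open>a b\<close> is off-diagonal, which turns the Lie rule into the product rule.\<close>
  have off: "\<tau> (a \<odot> b) = \<tau> a \<odot> b + a \<odot> \<tau> b"
    if a: "a \<in> \<A>" "corner i j a" and b: "b \<in> \<A>" "corner j l b" and il: "i \<noteq> l" for i j l a b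
  proof -
    have "b \<odot> a = 0" "b \<odot> \<tau> a = 0" "\<tau> b \<odot> a = 0"
      using a b il \<tau>_corner by (auto intro: corner_orth)
    moreover have "h (a \<odot> b) = 0"
      using h_off[OF _ corner_mult[OF a(2) b(2)] il] a b closed by simp
    ultimately show ?thesis
      using \<tau>_lie[OF a(1) b(1)] by simp
  qed
  define \<delta> where "\<delta> a b = \<tau> (a \<odot> b) - \<tau> a \<odot> b - a \<odot> \<tau> b" for a b
  have corners: "\<delta> a b = 0" if a: "a \<in> \<A>" "corner i j a" and b: "b \<in> \<A>" "corner k l b" for i j k l a b
  proof -
    consider "j \<noteq> k" | "j = k" "i \<noteq> l" | "j = k" "i = l" "i = j" | "j = k" "i = l" "i \<noteq> j"
      by blast
    then show ?thesis
    proof cases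
      case 1
      then have "a \<odot> b = 0" "\<tau> a \<odot> b = 0" "a \<odot> \<tau> b = 0"
        using a b \<tau>_corner by (auto intro: corner_orth)
      then show ?thesis
        by (simp add: \<delta>_def \<tau>_0)
    next
      case 2
      then show ?thesis
        using off[of a i j b l] a b by (simp add: \<delta>_def)
    next
      case 3
      \<comment> \<open>Products ending in an off-diagonal corner are covered by \<open>off\<close>;
        bracketing \<open>a b c\<close> in both ways exposes the defect at \<open>a\<close>,
        \<open>b\<close>.\<close>
      have "\<delta> a b \<odot> c = 0" if c: "c \<in> \<A>" "corner i (\<not> i) c" for c
      proof -
        have ab: "a \<odot> b \<in> \<A>" "corner i i (a \<odot> b)" and bc: "b \<odot> c \<in> \<A>" "corner i (\<not> i) (b \<odot> c)"
          using a b c 3 corner_mult by (auto intro: closed)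
        have "\<tau> (a \<odot> b) \<odot> c + a \<odot> b \<odot> \<tau> c = \<tau> (a \<odot> b \<odot> c)"
          using off[OF ab c] by simp
        also have "\<dots> = \<tau> a \<odot> (b \<odot> c) + a \<odot> \<tau> (b \<odot> c)"
          using off[of a i i "b \<odot> c" "\<not> i"] a bc 3 by (simp add: compose_assoc)
        also have "\<tau> (b \<odot> c) = \<tau> b \<odot> c + b \<odot> \<tau> c"
          using off[of b i i c "\<not> i"] b c 3 by simp
        finally show ?thesis
          by (simp add: \<delta>_def compose_simps algebra_simps)
      qed
      then have "\<delta> a b \<odot> E i = 0"
        by (rule prime_corner)
      moreover have "corner i i (\<tau> (a \<odot> b))" "corner i i (\<tau> a \<odot> b)" "corner i i (a \<odot> \<tau> b)"
        using a b 3 by (auto intro!: \<tau>_corner corner_mult closed)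
      then have "\<delta> a b \<odot> E i = \<delta> a b"
        by (simp add: \<delta>_def corner_def compose.diff_left)
      ultimately show ?thesis
        by simp
    next
      case 4
      let ?h = "h (a \<odot> b - b \<odot> a)"
      have ij: "corner i j a" "corner j i b" "j \<noteq> i"
        using a b 4 by simp_all
      have ab: "a \<odot> b \<in> \<A>" "b \<odot> a \<in> \<A>"
        using a b by (simp_all add: closed)
      have cs: "corner i i (a \<odot> b)" "corner j j (b \<odot> a)" "corner i i (\<tau> (a \<odot> b))"
        "corner j j (\<tau> (b \<odot> a))" "corner i i (\<tau> a \<odot> b)" "corner j j (b \<odot> \<tau> a)"
        "corner i i (a \<odot> \<tau> b)" "corner j j (\<tau> b \<odot> a)"
        using a(1) b(1) ij by (auto intro!: \<tau>_corner corner_mult closed)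
      have "\<tau> (a \<odot> b - b \<odot> a) = \<tau> (a \<odot> b) - \<tau> (b \<odot> a)"
        using \<tau>_add[of "a \<odot> b" "- (b \<odot> a)"] \<tau>_minus ab by (simp add: closed)
      with \<tau>_lie[OF a(1) b(1)] have eq: "\<tau> (a \<odot> b) - \<tau> (b \<odot> a) + sc ?h id_blinfun =
          \<tau> a \<odot> b - b \<odot> \<tau> a + (a \<odot> \<tau> b - \<tau> b \<odot> a)"
        by simp
      \<comment> \<open>Projecting to the two diagonal corners separates \<open>a b\<close> from
        \<open>b a\<close>; the scalar enters the two product rules with opposite signs, so it does
        not cancel in \<open>\<tau> (a b a)\<close>.\<close>
      have "\<tau> (a \<odot> b) + sc ?h (E i) = \<tau> a \<odot> b + a \<odot> \<tau> b"
        using arg_cong[OF eq, of "\<lambda>T. E i \<odot> T"] ij cs[THEN corner_E(1), of i]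
        by (simp add: compose.add_right compose.diff_right sc_compose E_bounded)
      moreover have "- \<tau> (b \<odot> a) + sc ?h (E j) = - (b \<odot> \<tau> a) - \<tau> b \<odot> a"
        using arg_cong[OF eq, of "\<lambda>T. E j \<odot> T"] ij cs[THEN corner_E(1), of j]
        by (simp add: compose.add_right compose.diff_right sc_compose E_bounded)
      ultimately have \<tau>_ab: "\<tau> (a \<odot> b) = \<tau> a \<odot> b + a \<odot> \<tau> b - sc ?h (E i)"
        and \<tau>_ba: "\<tau> (b \<odot> a) = b \<odot> \<tau> a + \<tau> b \<odot> a + sc ?h (E j)"
        by (auto simp: algebra_simps eq_neg_iff_add_eq_0)
      have "\<tau> (a \<odot> b) \<odot> a + a \<odot> b \<odot> \<tau> a = \<tau> a \<odot> (b \<odot> a) + a \<odot> \<tau> (b \<odot> a)"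
        using off[OF ab(1) cs(1) a(1) ij(1) ij(3)[symmetric]] off[OF a(1) ij(1) ab(2) cs(2) ij(3)[symmetric]]
        by (simp add: compose_assoc)
      then have "sc ?h a + sc ?h a = 0"
        using ij(1) unfolding \<tau>_ab \<tau>_ba corner_def
        by (simp add: compose_simps sc_compose algebra_bounded[OF a(1)] algebra_simps)
      then have "sc ?h a = 0"
        by (rule double_eq_0)
      \<comment> \<open>If \<open>a = 0\<close>, the scalar is \<open>h 0\<close>, which vanishes as
        well.\<close>
      then have "?h = 0"
        using h_0 by auto
      then show ?thesis
        by (simp add: \<delta>_def \<tau>_ab)
    qed
  qed
  have \<delta>_add: "additive_on \<A> (\<lambda>a. \<delta> a b)" "additive_on \<A> (\<lambda>a. \<delta> b a)" if "b \<in> \<A>" for b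
    using that by (auto simp: additive_on_def \<delta>_def \<tau>_add closed compose_simps algebra_simps)
  have "\<delta> a b = 0" if "a \<in> \<A>" "b \<in> \<A>" for a b
    using \<delta>_add corners that
    by (intro additive_on_corners[of "\<delta> a", OF _ additive_on_corners[of "\<lambda>a. \<delta> a _"]])
  then have "\<forall>a\<in>\<A>. \<forall>b\<in>\<A>. \<tau> (a \<odot> b) = \<tau> a \<odot> b + a \<odot> \<tau> b"
    by (simp add: \<delta>_def algebra_simps)
  moreover have "\<forall>a\<in>\<A>. L a = \<tau> a + sc (h a) id_blinfun"
    by (simp add: \<tau>_def)
  ultimately show ?thesis
    using \<tau>_add h_add \<tau>_bounded unfolding additive_on_def by blast
qed

end

text \<open>A derivation kills the integers, so at a polynomial \<open>q\<close> with integer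
  coefficients \<open>\<delta> (q x) = q' x * \<delta> x\<close>. If
  \<open>\<delta> x \<noteq> 0\<close>, a root of \<open>q\<close> is one of \<open>q'\<close>, and
  the descent on the degree ends at a nonzero constant.\<close>

lemma field_derivation_algebraic_0:
  fixes \<delta> :: "'k::field_char_0 \<Rightarrow> 'k"
  assumes add: "\<And>x y. \<delta> (x + y) = \<delta> x + \<delta> y" and mult: "\<And>x y. \<delta> (x * y) = \<delta> x * y + x * \<delta> y"
    and "algebraic x"
  shows "\<delta> x = 0"
proof -
  have \<delta>_0: "\<delta> 0 = 0" and \<delta>_1: "\<delta> 1 = 0"
    using add[of 0 0] mult[of 1 1] by simp_all
  have \<delta>_minus: "\<delta> (- y) = - \<delta> y" for y
    using add[of y "- y"] \<delta>_0 by (intro minus_unique[symmetric]) simp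
  have \<delta>_nat: "\<delta> (of_nat n) = 0" for n
    by (induction n) (simp_all add: add \<delta>_0 \<delta>_1)
  have \<delta>_int: "\<delta> y = 0" if "y \<in> \<int>" for y
    using that by (cases y rule: Ints_cases, elim ssubst) (metis \<delta>_nat \<delta>_minus int_cases2 neg_0_equal_iff_equal of_int_minus of_int_of_nat_eq)
  have \<delta>_poly: "\<delta> (poly p x) = poly (pderiv p) x * \<delta> x" if "\<And>i. coeff p i \<in> \<int>" for p
    using that
  proof (induction p)
    case (pCons a p)
    have "coeff p i \<in> \<int>" for i
      using pCons.prems[of "Suc i"] by simp
    then have "\<delta> (poly p x) = poly (pderiv p) x * \<delta> x"
      by (rule pCons.IH)
    moreover have "\<delta> a = 0"
      using pCons.prems[of 0] \<delta>_int by simp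
    ultimately show ?case
      by (simp add: add mult pderiv_pCons algebra_simps)
  qed (simp add: \<delta>_0)
  have "\<delta> x = 0" if "\<And>i. coeff p i \<in> \<int>" "p \<noteq> 0" "poly p x = 0" for p
    using that
  proof (induction "degree p" arbitrary: p rule: less_induct)
    case less
    show ?case
    proof (rule ccontr)
      assume nz: "\<delta> x \<noteq> 0"
      have "degree p \<noteq> 0"
      proof
        assume "degree p = 0"
        then obtain c where "p = [:c:]"
          by (rule degree_eq_zeroE)
        with less.prems(2,3) show False
          by simp
      qed
      moreover have "poly (pderiv p) x = 0"
        using \<delta>_poly[OF less.prems(1)] less.prems(3) nz \<delta>_0 by simp
      moreover have "coeff (pderiv p) i \<in> \<int>" for i
        unfolding coeff_pderiv by (intro Ints_mult less.prems(1) Ints_of_nat)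
      ultimately have "\<delta> x = 0"
        using less.hyps[of "pderiv p"] by (auto simp: degree_pderiv pderiv_eq_0_iff)
      with nz show False by simp
    qed
  qed
  then show ?thesis
    using assms(3) by (elim algebraicE) blast
qed

section \<open>Peirce decomposition along a rank-one idempotent\<close>

locale rank_one_peirce = peirce smul \<A> p
  for smul :: "'k::real_or_complex \<Rightarrow> 'x::banach \<Rightarrow> 'x" and \<A> p +
  assumes rank_one: "T \<in> \<B> \<Longrightarrow> \<exists>t. p \<odot> T \<odot> p = sc t p"
begin

abbreviation e :: "'x \<Rightarrow>\<^sub>L 'x" where "e \<equiv> E False"

lemma E_True: "E True = p"
  by (simp add: E_def)

lemma pe_sum: "p + e = id_blinfun"
  by (simp add: E_def)

lemma e_simps: "p \<odot> e = 0" "e \<odot> p = 0" "e \<odot> e = e"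
  "p \<odot> (e \<odot> T) = 0" "e \<odot> (p \<odot> T) = 0" "e \<odot> (e \<odot> T) = e \<odot> T"
  using E_orth[of True False] E_orth[of False True] E_orth'[of True False T]
    E_orth'[of False True T] E_idem[of False] E_idem'[of False T]
  by (simp_all add: E_True)

lemma p_bounded: "p \<in> \<B>"
  using p(1) by (rule algebra_bounded)

text \<open>Both diagonal corners of \<open>L p\<close> carry the same scalar: one because
  \<open>p\<close> has rank one, the other by evaluating \<open>L\<close> at
  \<open>[p, p b e] = p b e\<close>. An inner derivation removes the off-diagonal corners.\<close>

lemma lie_derivation_decompose:
  assumes L: "\<And>a. a \<in> \<A> \<Longrightarrow> L a \<in> \<B>" and add_on: "additive_on \<A> L"
    and lie: "\<And>a b. a \<in> \<A> \<Longrightarrow> b \<in> \<A> \<Longrightarrow>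
      L (a \<odot> b - b \<odot> a) = L a \<odot> b - b \<odot> L a + (a \<odot> L b - L b \<odot> a)"
  shows "\<exists>\<tau> h. (\<forall>a\<in>\<A>. \<tau> a \<in> \<B>) \<and> additive_on \<A> \<tau> \<and> additive_on \<A> h \<and>
    (\<forall>a\<in>\<A>. \<forall>b\<in>\<A>. \<tau> (a \<odot> b) = \<tau> a \<odot> b + a \<odot> \<tau> b) \<and> (\<forall>a\<in>\<A>. L a = \<tau> a + sc (h a) id_blinfun)"
proof -
  obtain c where pPp: "p \<odot> L p \<odot> p = sc c p"
    using rank_one L p(1) by blast
  have "p \<odot> b \<odot> (sc c e - e \<odot> L p \<odot> e) = 0" if b: "b \<in> \<A>" for b
  proof -
    let ?a = "p \<odot> b \<odot> e"
    have a: "?a \<in> \<A>"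
      using b p(1) by (intro E_compose algebra_closed)
    have "p \<odot> ?a - ?a \<odot> p = ?a"
      by (simp add: compose_assoc idem' e_simps)
    then have "L ?a = L p \<odot> ?a - ?a \<odot> L p + (p \<odot> L ?a - L ?a \<odot> p)"
      using lie[OF p(1) a] by simp
    then have "p \<odot> L ?a \<odot> e = p \<odot> (L p \<odot> ?a - ?a \<odot> L p + (p \<odot> L ?a - L ?a \<odot> p)) \<odot> e"
      by simp
    also have "\<dots> = p \<odot> L p \<odot> p \<odot> b \<odot> e - p \<odot> b \<odot> (e \<odot> L p \<odot> e) + p \<odot> L ?a \<odot> e"
      by (simp add: compose_simps idem' e_simps)
    finally have "p \<odot> L p \<odot> p \<odot> b \<odot> e = p \<odot> b \<odot> (e \<odot> L p \<odot> e)"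
      by simp
    moreover have "p \<odot> b \<odot> sc c e = sc c (p \<odot> b \<odot> e)"
      using b by (intro sc_compose_right bounded_ops_closed(4) p_bounded algebra_bounded)
    ultimately show ?thesis
      unfolding pPp by (simp add: sc_compose_left compose.diff_right)
  qed
  then have ePe: "e \<odot> L p \<odot> e = sc c e"
    using prime p(2) by fastforce
  \<comment> \<open>The signs make \<open>[s, p]\<close> equal to the off-diagonal part of
    \<open>L p\<close>.\<close>
  define s where "s = e \<odot> L p \<odot> p - p \<odot> L p \<odot> e"
  have s: "s \<in> \<B>"
    unfolding s_def using L[OF p(1)] by (intro bounded_ops_closed(2,4) E_bounded p_bounded)
  define M where "M a = L a - (s \<odot> a - a \<odot> s)" for a
  have "p \<odot> L p \<odot> p + e \<odot> L p \<odot> e + (e \<odot> L p \<odot> p + p \<odot> L p \<odot> e) = (p + e) \<odot> L p \<odot> (p + e)"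
    by (simp only: compose.add_left compose.add_right ac_simps)
  also have "\<dots> = L p"
    by (simp add: pe_sum)
  finally have "L p - (e \<odot> L p \<odot> p + p \<odot> L p \<odot> e) = sc c p + sc c e"
    unfolding pPp ePe by (metis add_diff_cancel_right')
  moreover have "s \<odot> p - p \<odot> s = e \<odot> L p \<odot> p + p \<odot> L p \<odot> e"
    unfolding s_def by (simp add: compose_simps idem idem' e_simps)
  ultimately have "M p = sc c p + sc c e"
    by (simp only: M_def)
  then have Mp: "M p = sc c id_blinfun"
    by (simp add: pe_sum flip: operators.scale_right_distrib)
  have "\<exists>\<tau> h. (\<forall>a\<in>\<A>. \<tau> a \<in> \<B>) \<and> additive_on \<A> \<tau> \<and> additive_on \<A> h \<and>
    (\<forall>a\<in>\<A>. \<forall>b\<in>\<A>. \<tau> (a \<odot> b) = \<tau> a \<odot> b + a \<odot> \<tau> b) \<and> (\<forall>a\<in>\<A>. M a = \<tau> a + sc (h a) id_blinfun)"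
  proof (rule lie_derivation_decompose_normalized)
    show "M a \<in> \<B>" if "a \<in> \<A>" for a
      unfolding M_def using that s by (simp add: bounded_ops_closed L algebra_bounded)
    show "additive_on \<A> M"
      using add_on by (simp add: additive_on_def M_def compose_simps)
    show "M (a \<odot> b - b \<odot> a) = M a \<odot> b - b \<odot> M a + (a \<odot> M b - M b \<odot> a)" if "a \<in> \<A>" "b \<in> \<A>" for a b
      unfolding M_def lie[OF that] by (simp add: compose_simps)
    show "M p \<odot> a = a \<odot> M p" if "a \<in> \<A>" for a
      using that by (simp add: Mp sc_compose algebra_bounded)
  qed
  then obtain \<tau> h where \<tau>: "\<forall>a\<in>\<A>. \<tau> a \<in> \<B>" "additive_on \<A> \<tau>" "additive_on \<A> h"
    "\<forall>a\<in>\<A>. \<forall>b\<in>\<A>. \<tau> (a \<odot> b) = \<tau> a \<odot> b + a \<odot> \<tau> b" "\<forall>a\<in>\<A>. M a = \<tau> a + sc (h a) id_blinfun"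
    by blast
  let ?\<tau> = "\<lambda>a. \<tau> a + (s \<odot> a - a \<odot> s)"
  have "\<forall>a\<in>\<A>. ?\<tau> a \<in> \<B>"
    using \<tau>(1) s by (simp add: bounded_ops_closed algebra_bounded)
  moreover have "additive_on \<A> ?\<tau>"
    using \<tau>(2) by (simp add: additive_on_def compose_simps)
  moreover have "\<forall>a\<in>\<A>. \<forall>b\<in>\<A>. ?\<tau> (a \<odot> b) = ?\<tau> a \<odot> b + a \<odot> ?\<tau> b"
    using \<tau>(4) by (simp add: compose_simps)
  moreover have "\<forall>a\<in>\<A>. L a = ?\<tau> a + sc (h a) id_blinfun"
    using \<tau>(5) by (simp add: M_def algebra_simps)
  ultimately show ?thesis
    using \<tau>(3) by (intro exI[of _ ?\<tau>] exI[of _ h] conjI)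
qed

text \<open>The value at \<open>p\<close> turns out to be \<open>c p\<close>. For
  \<open>u = g - c\<close>, taking \<open>b = p\<close> gives \<open>u a p = p u a = 0\<close>, and
  primeness yields \<open>u = 0\<close> first on \<open>p \<A>\<close>, then on
  \<open>\<A>\<close>.\<close>

lemma symmetric_jordan_scalar:
  assumes g: "\<And>a. a \<in> \<A> \<Longrightarrow> g a \<in> \<B>"
    and sym: "\<And>a b. a \<in> \<A> \<Longrightarrow> b \<in> \<A> \<Longrightarrow> g a \<odot> b + b \<odot> g a = a \<odot> g b + g b \<odot> a"
  shows "\<exists>c. \<forall>a\<in>\<A>. g a = sc c a"
proof -
  define s where "s = g p"
  have s: "s \<in> \<B>"
    unfolding s_def using g p(1) .
  \<comment> \<open>Compression by \<open>e\<close> kills the side that contains \<open>p\<close>.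
    The elements \<open>a p\<close>, \<open>p a\<close> and \<open>e a e\<close> then dispose of
    three corners of \<open>s\<close>.\<close>
  have ese: "e \<odot> (a \<odot> (s \<odot> e)) + e \<odot> (s \<odot> (a \<odot> e)) = 0" if "a \<in> \<A>" for a
  proof -
    have "e \<odot> (a \<odot> s + s \<odot> a) \<odot> e = e \<odot> (g a \<odot> p + p \<odot> g a) \<odot> e"
      using sym[OF that p(1)] by (simp only: s_def)
    then show ?thesis
      by (simp add: compose_simps e_simps)
  qed
  have "e \<odot> a \<odot> (p \<odot> s \<odot> e) = 0" if "a \<in> \<A>" for a
    using ese[OF algebra_closed(4)[OF that p(1)]]
    by (simp add: compose_assoc e_simps)
  then have pse: "p \<odot> s \<odot> e = 0"
    using prime E_nonzero by blast
  have "(e \<odot> s \<odot> p) \<odot> a \<odot> e = 0" if "a \<in> \<A>" for a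
    using ese[OF algebra_closed(4)[OF p(1) that]]
    by (simp add: compose_assoc e_simps)
  then have esp: "e \<odot> s \<odot> p = 0"
    using prime E_nonzero by blast
  have "(e \<odot> s \<odot> e) \<odot> a \<odot> e + e \<odot> a \<odot> (e \<odot> s \<odot> e) = 0" if "a \<in> \<A>" for a
    using ese[OF E_compose(1)[OF E_compose(2)[OF that]], of False False]
    by (simp add: compose_assoc e_simps add.commute)
  then have "e \<odot> s \<odot> e = 0"
    using prime_symmetric[OF E_bounded, of "e \<odot> s \<odot> e"] E_nonzero by blast
  moreover have "(p + e) \<odot> s \<odot> (p + e) = s"
    by (simp add: pe_sum)
  then have "s = p \<odot> s \<odot> p + p \<odot> s \<odot> e + (e \<odot> s \<odot> p + e \<odot> s \<odot> e)"
    by (simp only: compose.add_left compose.add_right) (simp only: ac_simps)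
  ultimately have "s = p \<odot> s \<odot> p"
    using pse esp by simp
  then obtain c where c: "s = sc c p"
    using rank_one[OF s] by auto
  define u where "u a = g a - sc c a" for a
  have u_sym: "u a \<odot> b + b \<odot> u a = a \<odot> u b + u b \<odot> a" if "a \<in> \<A>" "b \<in> \<A>" for a b
    using sym[OF that] that
    by (simp add: u_def compose_simps sc_compose algebra_bounded algebra_simps)
  have up: "u a \<odot> p = 0" and pu: "p \<odot> u a = 0" if a: "a \<in> \<A>" for a
  proof -
    have sum: "u a \<odot> p + p \<odot> u a = 0"
      using u_sym[OF a p(1)] c by (simp add: u_def s_def)
    then have "p \<odot> (u a \<odot> p + p \<odot> u a) = 0" "(u a \<odot> p + p \<odot> u a) \<odot> p = 0"
      by simp_all
    then have 1: "p \<odot> (u a \<odot> p) + p \<odot> u a = 0" "u a \<odot> p + p \<odot> (u a \<odot> p) = 0"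
      by (simp_all add: compose_simps idem idem')
    then have "p \<odot> (p \<odot> (u a \<odot> p) + p \<odot> u a) \<odot> p = 0"
      by simp
    then have "p \<odot> (u a \<odot> p) = 0"
      by - (rule double_eq_0, simp add: compose_simps idem idem')
    with 1 show "u a \<odot> p = 0" "p \<odot> u a = 0"
      by simp_all
  qed
  have u_pc: "u (p \<odot> c) = 0" if c: "c \<in> \<A>" for c
  proof -
    have "u (p \<odot> c) \<odot> d \<odot> p = 0" if d: "d \<in> \<A>" for d
    proof -
      have mem: "p \<odot> c \<in> \<A>" "d \<odot> p \<in> \<A>"
        using c d p(1) by (simp_all add: algebra_closed)
      \<comment> \<open>Multiplication by \<open>p\<close> from the left kills the left side and
        fixes the right one, so both vanish.\<close>
      have eq: "u (p \<odot> c) \<odot> (d \<odot> p) = p \<odot> (c \<odot> u (d \<odot> p))"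
        using u_sym[OF mem] pu[OF mem(1)] up[OF mem(2)]
        by (simp add: compose_assoc) (metis compose.zero_left compose_assoc add_0_right)
      have "p \<odot> (c \<odot> u (d \<odot> p)) = p \<odot> (u (p \<odot> c) \<odot> (d \<odot> p))"
        unfolding eq by (simp add: idem')
      also have "\<dots> = 0"
        using pu[OF mem(1)] by (simp flip: compose_assoc)
      finally show ?thesis
        using eq by (simp add: compose_assoc)
    qed
    then show ?thesis
      using prime p(2) by blast
  qed
  have "u a = 0" if a: "a \<in> \<A>" for a
  proof -
    have "p \<odot> b \<odot> u a = 0" if b: "b \<in> \<A>" for b
      using u_sym[OF a algebra_closed(4)[OF p(1) b]] u_pc[OF b] up[OF a]
      by (simp flip: compose_assoc)
    then show ?thesis
      using prime p(2) by blast
  qed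
  then show ?thesis
    by (auto simp: u_def)
qed

end

section \<open>\<open>\<xi>\<close>-Lie derivations\<close>

context standard_algebra
begin

lemma additive_on_diff:
  assumes "additive_on \<A> D" "a \<in> \<A>" "b \<in> \<A>"
  shows "D (a - b) = D a - D b"
proof -
  have "D (a - b + b) = D (a - b) + D b"
    using assms algebra_closed(2) unfolding additive_on_def by blast
  then show ?thesis
    by simp
qed

text \<open>The premises \<open>scalar\<close> and \<open>zero\<close> isolate what depends on the
  dimension; they are established separately on a line and on larger spaces.\<close>

lemma xi_lie_derivation_reduce:
  assumes L: "\<And>a. a \<in> \<A> \<Longrightarrow> L a \<in> \<B>" and add_on: "additive_on \<A> L"
    and \<xi>: "\<xi> \<noteq> 1" "\<xi> \<noteq> - 1"
    and lie: "\<And>a b. a \<in> \<A> \<Longrightarrow> b \<in> \<A> \<Longrightarrow>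
      L (a \<odot> b - sc \<xi> (b \<odot> a)) = L a \<odot> b - sc \<xi> (b \<odot> L a) + (a \<odot> L b - sc \<xi> (L b \<odot> a))"
    and scalar: "\<And>g. (\<And>a. a \<in> \<A> \<Longrightarrow> g a \<in> \<B>) \<Longrightarrow>
      (\<And>a b. a \<in> \<A> \<Longrightarrow> b \<in> \<A> \<Longrightarrow> g a \<odot> b + b \<odot> g a = a \<odot> g b + g b \<odot> a) \<Longrightarrow>
      \<exists>c. \<forall>a\<in>\<A>. g a = sc c a"
    and zero: "\<And>c D. (\<And>a. a \<in> \<A> \<Longrightarrow> D a \<in> \<B>) \<Longrightarrow> additive_on \<A> D \<Longrightarrow>
      (\<And>a b. a \<in> \<A> \<Longrightarrow> b \<in> \<A> \<Longrightarrow> D (a \<odot> b) = D a \<odot> b + a \<odot> D b) \<Longrightarrow>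
      (\<And>a. a \<in> \<A> \<Longrightarrow> D (sc \<xi> a) = sc \<xi> (D a) - sc ((1 - \<xi>) * c) a) \<Longrightarrow>
      (\<And>a b. a \<in> \<A> \<Longrightarrow> b \<in> \<A> \<Longrightarrow> sc c (a \<odot> b - b \<odot> a) = 0) \<Longrightarrow> c = 0"
  shows "additive_derivation smul \<A> L \<and> (\<forall>a\<in>\<A>. L (sc \<xi> a) = sc \<xi> (L a))"
proof -
  note closed = algebra_closed
  note distribs = operators.scale_right_distrib operators.scale_left_distrib
    operators.scale_right_diff_distrib operators.scale_left_diff_distrib
  define \<kappa> where "\<kappa> = 1 - \<xi>"
  define \<mu> where "\<mu> = 1 + \<xi>"
  have \<kappa>: "\<kappa> \<noteq> 0"
    using \<xi> by (simp add: \<kappa>_def)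
  have L_add: "L (a + b) = L a + L b" if "a \<in> \<A>" "b \<in> \<A>" for a b
    using add_on that by (simp add: additive_on_def)
  \<comment> \<open>The sum of the rules for \<open>(a, b)\<close> and \<open>(b, a)\<close> has the
    factor \<open>\<kappa>\<close>; their difference, in \<open>comm\<close>, has the factor
    \<open>\<mu>\<close>.\<close>
  have jordan: "L (sc \<kappa> (a \<odot> b + b \<odot> a)) = sc \<kappa> (L a \<odot> b + b \<odot> L a + (a \<odot> L b + L b \<odot> a))"
    if "a \<in> \<A>" "b \<in> \<A>" for a b
  proof -
    have "sc \<kappa> (a \<odot> b + b \<odot> a) = (a \<odot> b - sc \<xi> (b \<odot> a)) + (b \<odot> a - sc \<xi> (a \<odot> b))"
      by (simp add: \<kappa>_def distribs)
    also have "L \<dots> = L (a \<odot> b - sc \<xi> (b \<odot> a)) + L (b \<odot> a - sc \<xi> (a \<odot> b))"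
      using that by (intro L_add closed)
    also have "\<dots> = sc \<kappa> (L a \<odot> b + b \<odot> L a + (a \<odot> L b + L b \<odot> a))"
      unfolding lie[OF that] lie[OF that(2,1)] by (simp add: \<kappa>_def distribs)
    finally show ?thesis .
  qed
  have comm: "L (sc \<mu> (a \<odot> b - b \<odot> a)) = sc \<mu> (L a \<odot> b - b \<odot> L a + (a \<odot> L b - L b \<odot> a))"
    if "a \<in> \<A>" "b \<in> \<A>" for a b
  proof -
    have "sc \<mu> (a \<odot> b - b \<odot> a) = (a \<odot> b - sc \<xi> (b \<odot> a)) - (b \<odot> a - sc \<xi> (a \<odot> b))"
      by (simp add: \<mu>_def distribs)
    also have "L \<dots> = L (a \<odot> b - sc \<xi> (b \<odot> a)) - L (b \<odot> a - sc \<xi> (a \<odot> b))"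
      using that by (intro additive_on_diff[OF add_on] closed)
    also have "\<dots> = sc \<mu> (L a \<odot> b - b \<odot> L a + (a \<odot> L b - L b \<odot> a))"
      unfolding lie[OF that] lie[OF that(2,1)] by (simp add: \<mu>_def distribs)
    finally show ?thesis .
  qed
  define g where "g a = L (sc \<kappa> a) - sc \<kappa> (L a)" for a
  have "\<exists>c. \<forall>a\<in>\<A>. g a = sc c a"
  proof (rule scalar)
    show "g a \<in> \<B>" if "a \<in> \<A>" for a
      unfolding g_def using that by (intro bounded_ops_closed(2,5) L closed)
    fix a b
    assume ab: "a \<in> \<A>" "b \<in> \<A>"
    \<comment> \<open>In a Jordan product \<open>\<kappa>\<close> may stand at either factor, so
      \<open>jordan\<close> expands one value of \<open>L\<close> in two ways.\<close>
    have "sc \<kappa> a \<odot> b + b \<odot> sc \<kappa> a = a \<odot> sc \<kappa> b + sc \<kappa> b \<odot> a"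
      using ab by (simp add: sc_compose algebra_bounded)
    then have "sc \<kappa> (L (sc \<kappa> a) \<odot> b + b \<odot> L (sc \<kappa> a) + (sc \<kappa> a \<odot> L b + L b \<odot> sc \<kappa> a)) =
        sc \<kappa> (L a \<odot> sc \<kappa> b + sc \<kappa> b \<odot> L a + (a \<odot> L (sc \<kappa> b) + L (sc \<kappa> b) \<odot> a))"
      using jordan[OF closed(5)[OF ab(1)] ab(2), of \<kappa>] jordan[OF ab(1) closed(5)[OF ab(2)], of \<kappa>]
      by (simp only:)
    then have "L (sc \<kappa> a) \<odot> b + b \<odot> L (sc \<kappa> a) + (sc \<kappa> a \<odot> L b + L b \<odot> sc \<kappa> a) =
        L a \<odot> sc \<kappa> b + sc \<kappa> b \<odot> L a + (a \<odot> L (sc \<kappa> b) + L (sc \<kappa> b) \<odot> a)"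
      using \<kappa> by (metis operators.scale_left_imp_eq)
    then show "g a \<odot> b + b \<odot> g a = a \<odot> g b + g b \<odot> a"
      using ab L unfolding g_def
      by (simp add: compose_simps sc_compose algebra_bounded algebra_simps)
  qed
  then obtain c' where c': "\<And>a. a \<in> \<A> \<Longrightarrow> g a = sc c' a"
    by blast
  \<comment> \<open>With this normalisation \<open>L j + c j\<close>, for
    \<open>j = a b + b a\<close>, is the Jordan expression in \<open>L\<close>. Shifting
    \<open>L\<close> by \<open>c\<close> in every factor contributes \<open>2 c j\<close>, which
    leaves the Jordan rule for \<open>L - c\<close>.\<close>
  define c where "c = c' / \<kappa>"
  have L_\<kappa>: "L (sc \<kappa> a) = sc \<kappa> (L a) + sc (\<kappa> * c) a" if "a \<in> \<A>" for a
    using c'[OF that] \<kappa> by (simp add: g_def c_def algebra_simps)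
  define D where "D a = L a - sc c a" for a
  have D_bounded: "D a \<in> \<B>" if "a \<in> \<A>" for a
    unfolding D_def using that by (intro bounded_ops_closed(2,5) L algebra_bounded)
  have D_add: "additive_on \<A> D"
    using L_add by (simp add: additive_on_def D_def distribs)
  have D_mult: "D (a \<odot> b) = D a \<odot> b + a \<odot> D b" if ab: "a \<in> \<A>" "b \<in> \<A>" for a b
  proof (rule jordan_derivation_is_derivation[OF D_bounded D_add _ ab])
    fix a b
    assume ab: "a \<in> \<A>" "b \<in> \<A>"
    have "sc \<kappa> (L (a \<odot> b + b \<odot> a) + sc c (a \<odot> b + b \<odot> a)) =
        sc \<kappa> (L a \<odot> b + b \<odot> L a + (a \<odot> L b + L b \<odot> a))"
      using jordan[OF ab] L_\<kappa>[of "a \<odot> b + b \<odot> a"] ab by (simp add: closed distribs)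
    then have "L (a \<odot> b + b \<odot> a) + sc c (a \<odot> b + b \<odot> a) = L a \<odot> b + b \<odot> L a + (a \<odot> L b + L b \<odot> a)"
      using \<kappa> by simp
    then have "L (a \<odot> b + b \<odot> a) = L a \<odot> b + b \<odot> L a + (a \<odot> L b + L b \<odot> a) - sc c (a \<odot> b + b \<odot> a)"
      by (simp only: eq_diff_eq)
    then show "D (a \<odot> b + b \<odot> a) = D a \<odot> b + a \<odot> D b + D b \<odot> a + b \<odot> D a"
      using ab by (simp add: D_def compose_simps sc_compose algebra_bounded distribs algebra_simps)
  qed
  have D_\<xi>: "D (sc \<xi> a) = sc \<xi> (D a) - sc (\<kappa> * c) a" if "a \<in> \<A>" for a
  proof -
    have "D (sc \<kappa> a) = D (a - sc \<xi> a)"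
      by (simp add: \<kappa>_def distribs)
    also have "\<dots> = D a - D (sc \<xi> a)"
      using that by (intro additive_on_diff[OF D_add] closed)
    finally have "D (sc \<xi> a) = D a - D (sc \<kappa> a)"
      by simp
    also have "D (sc \<kappa> a) = sc \<kappa> (D a + sc c a)"
      using L_\<kappa>[OF that] by (simp add: D_def distribs mult.commute)
    finally show ?thesis
      by (simp add: \<kappa>_def distribs algebra_simps)
  qed
  \<comment> \<open>Write \<open>w = [a, b]\<close>. Computing \<open>L (\<mu> w)\<close> from
    \<open>comm\<close> and from \<open>D\<close> gives \<open>c w\<close> the coefficients
    \<open>2 \<mu>\<close> and \<open>\<mu> - \<kappa>\<close>, which differ by
    \<open>\<mu> + \<kappa> = 2\<close>.\<close>
  have "sc c (a \<odot> b - b \<odot> a) = 0" if ab: "a \<in> \<A>" "b \<in> \<A>" for a b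
  proof -
    let ?w = "a \<odot> b - b \<odot> a"
    have w: "?w \<in> \<A>"
      using ab by (intro closed)
    have Dw: "D ?w = D a \<odot> b + a \<odot> D b - (D b \<odot> a + b \<odot> D a)"
      using ab by (simp add: additive_on_diff[OF D_add] D_mult closed)
    have "L a \<odot> b - b \<odot> L a + (a \<odot> L b - L b \<odot> a) = D ?w + (sc c ?w + sc c ?w)"
      unfolding Dw using ab
      by (simp add: D_def compose_simps sc_compose algebra_bounded distribs algebra_simps)
    then have "L (sc \<mu> ?w) = sc \<mu> (D ?w + (sc c ?w + sc c ?w))"
      using comm[OF ab] by simp
    moreover have "sc \<mu> ?w = ?w + sc \<xi> ?w"
      by (simp add: \<mu>_def distribs)
    then have "D (sc \<mu> ?w) = D ?w + D (sc \<xi> ?w)"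
      using D_add w closed(5)[OF w] by (simp add: additive_on_def)
    then have "L (sc \<mu> ?w) = D ?w + (sc \<xi> (D ?w) - sc (\<kappa> * c) ?w) + sc (c * \<mu>) ?w"
      unfolding D_\<xi>[OF w] by (simp add: D_def algebra_simps)
    ultimately have "sc c ?w + sc c ?w = 0"
      by (simp add: \<kappa>_def \<mu>_def distribs algebra_simps)
    then show ?thesis
      by (rule double_eq_0)
  qed
  then have "c = 0"
    using zero[of D c] D_bounded D_add D_mult D_\<xi> by (simp add: \<kappa>_def)
  then have "L = D"
    by (simp add: fun_eq_iff D_def)
  then show ?thesis
    using D_bounded D_add D_mult D_\<xi> \<open>c = 0\<close> by (auto simp: additive_derivation_def)
qed

text \<open>Take \<open>p = rank_one x f\<close> with \<open>f x = 1\<close>: then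
  \<open>p T p = f (T x) p\<close>, and a vector outside the line of \<open>x\<close> shows that
  \<open>p\<close> is not the identity.\<close>

lemma rank_one_peirce_exists:
  assumes "x \<noteq> 0" "span {x} \<noteq> UNIV"
  obtains p where "rank_one_peirce smul \<A> p"
proof -
  obtain f where f: "functional f" "f x = 1"
    using assms(1) by (rule functional_separates)
  let ?p = "rank_one x f"
  note apply_p = rank_one_apply[OF f(1)]
  obtain y where y: "y \<notin> span {x}"
    using assms(2) by blast
  have "rank_one_peirce smul \<A> ?p"
  proof
    show "?p \<in> \<A>"
      using f(1) by (rule rank_one_algebra)
    show "?p \<noteq> 0"
      using apply_p[of x x] f(2) assms(1) by auto
    show "?p \<noteq> id_blinfun"
      using apply_p[of x y] y by (metis blinfun_apply_id_blinfun insertI1 span_base span_scale)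
    show "?p \<odot> ?p = ?p"
      by (rule blinfun_eqI) (simp add: apply_p functional_smul[OF f(1)] f(2))
    show "\<exists>t. ?p \<odot> T \<odot> ?p = sc t ?p" if "T \<in> \<B>" for T
      using that by (intro exI[of _ "f (T x)"] blinfun_eqI)
        (simp add: apply_p functional_smul[OF f(1)] op_scale_apply bounded_opsD mult.commute)
  qed
  then show thesis
    by (rule that)
qed

lemma dim_one:
  assumes "x \<noteq> 0" "span {x} = UNIV"
  shows "dim UNIV = 1" and "id_blinfun \<in> \<A>" and "id_blinfun \<noteq> (0 :: 'x \<Rightarrow>\<^sub>L 'x)"
    and "T \<in> \<B> \<Longrightarrow> \<exists>t. T = sc t id_blinfun"
proof -
  have "independent {x}"
    using assms(1) by (simp add: independent_insert)
  then show "dim UNIV = 1"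
    using assms(2) dim_eq_card[of "{x}" UNIV] by simp
  have "finite_rank smul id_blinfun"
    unfolding finite_rank_def using assms(2) by (intro exI[of _ "{x}"]) simp
  then show "id_blinfun \<in> \<A>"
    using std bounded_ops_closed(6) by (simp add: standard_operator_algebra_def)
  show "id_blinfun \<noteq> (0 :: 'x \<Rightarrow>\<^sub>L 'x)"
    using assms(1) by (metis blinfun_apply_id_blinfun zero_blinfun.rep_eq)
  assume T: "T \<in> \<B>"
  have gen: "\<exists>s. y = smul s x" for y
    using assms(2) span_singleton[of x] by (metis UNIV_I imageE)
  obtain t where "T x = smul t x"
    using gen by blast
  then have "T y = smul t y" for y
    using gen[of y] T by (auto simp: bounded_opsD mult.commute)
  then show "\<exists>t. T = sc t id_blinfun"
    by (intro exI[of _ t] blinfun_eqI) (simp add: op_scale_apply)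
qed

text \<open>\<open>L\<close> and \<open>\<tau>\<close> obey the same commutator rule, in which
  scalar parts cancel; so they agree at commutators, where \<open>h\<close> must vanish.\<close>

lemma lie_derivation_standard_form:
  assumes p: "rank_one_peirce smul \<A> p" and L: "additive_xi_Lie_derivation smul 1 \<A> L"
  shows "\<exists>\<tau> h. additive_derivation smul \<A> \<tau> \<and> additive_on \<A> h \<and>
    (\<forall>A\<in>\<A>. \<forall>B\<in>\<A>. h (commutator A B) = 0) \<and> (\<forall>A\<in>\<A>. L A = \<tau> A + sc (h A) id_blinfun)"
proof -
  interpret rank_one_peirce smul \<A> p
    by (rule p)
  have lie: "L (a \<odot> b - b \<odot> a) = L a \<odot> b - b \<odot> L a + (a \<odot> L b - L b \<odot> a)"
    if "a \<in> \<A>" "b \<in> \<A>" for a b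
    using L that by (simp add: additive_xi_Lie_derivation_def bracket_def)
  have "\<exists>\<tau> h. (\<forall>a\<in>\<A>. \<tau> a \<in> \<B>) \<and> additive_on \<A> \<tau> \<and> additive_on \<A> h \<and>
    (\<forall>a\<in>\<A>. \<forall>b\<in>\<A>. \<tau> (a \<odot> b) = \<tau> a \<odot> b + a \<odot> \<tau> b) \<and> (\<forall>a\<in>\<A>. L a = \<tau> a + sc (h a) id_blinfun)"
    using L by (intro lie_derivation_decompose) (auto simp: additive_xi_Lie_derivation_def bracket_def)
  then obtain \<tau> h where \<tau>: "\<forall>a\<in>\<A>. \<tau> a \<in> \<B>" "additive_on \<A> \<tau>" "additive_on \<A> h"
    "\<And>a b. a \<in> \<A> \<Longrightarrow> b \<in> \<A> \<Longrightarrow> \<tau> (a \<odot> b) = \<tau> a \<odot> b + a \<odot> \<tau> b"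
    "\<And>a. a \<in> \<A> \<Longrightarrow> L a = \<tau> a + sc (h a) id_blinfun"
    by blast
  have "h (commutator a b) = 0" if ab: "a \<in> \<A>" "b \<in> \<A>" for a b
  proof -
    let ?w = "a \<odot> b - b \<odot> a"
    have w: "?w \<in> \<A>"
      using ab by (intro algebra_closed)
    have "\<tau> ?w = \<tau> a \<odot> b - b \<odot> \<tau> a + (a \<odot> \<tau> b - \<tau> b \<odot> a)"
      using ab by (simp add: additive_on_diff[OF \<tau>(2)] \<tau>(4) algebra_closed)
    moreover have "L ?w = \<tau> a \<odot> b - b \<odot> \<tau> a + (a \<odot> \<tau> b - \<tau> b \<odot> a)"
      using ab by (simp add: lie \<tau>(5) compose_simps sc_compose algebra_bounded)
    ultimately have "sc (h ?w) id_blinfun = 0"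
      using \<tau>(5)[OF w] by (metis add_cancel_left_right)
    moreover have "id_blinfun \<noteq> (0 :: 'x \<Rightarrow>\<^sub>L 'x)"
      using p(2) by (metis compose.zero_left compose_id(1))
    ultimately show ?thesis
      by (simp add: commutator_def)
  qed
  then show ?thesis
    using \<tau> unfolding additive_derivation_def by (intro exI[of _ \<tau>] exI[of _ h]) auto
qed

lemma xi_lie_derivation_is_derivation:
  assumes \<xi>: "\<xi> \<noteq> 1" "\<xi> \<noteq> - 1" and L: "additive_xi_Lie_derivation smul \<xi> \<A> L"
    and algebraic: "dim UNIV = 1 \<Longrightarrow> algebraic \<xi>"
  shows "additive_derivation smul \<A> L \<and> (\<forall>a\<in>\<A>. L (sc \<xi> a) = sc \<xi> (L a))"
proof -
  have L': "a \<in> \<A> \<Longrightarrow> L a \<in> \<B>" "additive_on \<A> L"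
    "a \<in> \<A> \<Longrightarrow> b \<in> \<A> \<Longrightarrow>
      L (a \<odot> b - sc \<xi> (b \<odot> a)) = L a \<odot> b - sc \<xi> (b \<odot> L a) + (a \<odot> L b - sc \<xi> (L b \<odot> a))" for a b
    using L by (auto simp: additive_xi_Lie_derivation_def bracket_def)
  consider x where "x \<noteq> (0::'x)" "span {x} \<noteq> UNIV" | x where "x \<noteq> (0::'x)" "span {x} = UNIV"
    | "\<And>x. x = (0::'x)"
    by blast
  then show ?thesis
  proof cases
    case (1 x)
    then obtain p where "rank_one_peirce smul \<A> p"
      by (rule rank_one_peirce_exists)
    then interpret rank_one_peirce smul \<A> p .
    show ?thesis
    proof (rule xi_lie_derivation_reduce[OF L'(1,2) \<xi> L'(3)])
      show "\<exists>c. \<forall>a\<in>\<A>. g a = sc c a"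
        if "\<And>a. a \<in> \<A> \<Longrightarrow> g a \<in> \<B>"
          "\<And>a b. a \<in> \<A> \<Longrightarrow> b \<in> \<A> \<Longrightarrow> g a \<odot> b + b \<odot> g a = a \<odot> g b + g b \<odot> a" for g
        using that by (rule symmetric_jordan_scalar)
    next
      fix c
      assume c: "\<And>a b. a \<in> \<A> \<Longrightarrow> b \<in> \<A> \<Longrightarrow> sc c (a \<odot> b - b \<odot> a) = 0"
      show "c = 0"
      proof (rule ccontr)
        assume "c \<noteq> 0"
        \<comment> \<open>Since \<open>[p, e b] = - e b p\<close>, a nonzero \<open>c\<close> would
          force \<open>e \<A> p = 0\<close>, against primeness.\<close>
        have "e \<odot> b \<odot> p = 0" if b: "b \<in> \<A>" for b
        proof -
          have "e \<odot> b \<in> \<A>"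
            using b by (rule E_compose)
          then have "p \<odot> (e \<odot> b) - e \<odot> b \<odot> p = 0"
            using c[OF p(1), of "e \<odot> b"] \<open>c \<noteq> 0\<close> by simp
          then show ?thesis
            by (simp add: e_simps)
        qed
        then show False
          using prime E_nonzero p(2) by blast
      qed
    qed
  next
    case (2 x)
    note dim = dim_one[OF 2]
    show ?thesis
    proof (rule xi_lie_derivation_reduce[OF L'(1,2) \<xi> L'(3)])
      fix g
      assume g: "\<And>a. a \<in> \<A> \<Longrightarrow> g a \<in> \<B>"
        and sym: "\<And>a b. a \<in> \<A> \<Longrightarrow> b \<in> \<A> \<Longrightarrow> g a \<odot> b + b \<odot> g a = a \<odot> g b + g b \<odot> a"
      obtain c where c: "g id_blinfun = sc c id_blinfun"
        using dim(4) g dim(2) by blast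
      \<comment> \<open>With the identity as second argument, the symmetric equation reads
        \<open>2 g a = 2 c a\<close>.\<close>
      have "g a = sc c a" if "a \<in> \<A>" for a
        using sym[OF that dim(2)] that by - (rule double_cancel, simp add: c sc_compose algebra_bounded)
      then show "\<exists>c. \<forall>a\<in>\<A>. g a = sc c a"
        by blast
    next
      fix c D
      assume D: "\<And>a. a \<in> \<A> \<Longrightarrow> D a \<in> \<B>" "additive_on \<A> D"
        "\<And>a b. a \<in> \<A> \<Longrightarrow> b \<in> \<A> \<Longrightarrow> D (a \<odot> b) = D a \<odot> b + a \<odot> D b"
        "\<And>a. a \<in> \<A> \<Longrightarrow> D (sc \<xi> a) = sc \<xi> (D a) - sc ((1 - \<xi>) * c) a"
      let ?I = "id_blinfun :: 'x \<Rightarrow>\<^sub>L 'x"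
      have I: "sc t ?I \<in> \<A>" "sc s ?I = sc t ?I \<longleftrightarrow> s = t" for s t
        using dim(2,3) by (simp_all add: algebra_closed)
      \<comment> \<open>Operators on a line are scalars, so \<open>D\<close> becomes an additive
        derivation of the field.\<close>
      define \<delta> where "\<delta> t = (SOME s. D (sc t ?I) = sc s ?I)" for t
      have \<delta>: "D (sc t ?I) = sc (\<delta> t) ?I" for t
        unfolding \<delta>_def by (rule someI_ex, rule dim(4), rule D(1), rule I(1))
      have "\<delta> \<xi> = 0"
      proof (rule field_derivation_algebraic_0[of \<delta>])
        show "\<delta> (s + t) = \<delta> s + \<delta> t" for s t
        proof -
          have "sc (\<delta> (s + t)) ?I = sc (\<delta> s + \<delta> t) ?I"
            using D(2) I(1) unfolding additive_on_def
            by (simp add: \<delta>[symmetric] operators.scale_left_distrib)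
          then show ?thesis
            by (simp only: I(2))
        qed
        show "\<delta> (s * t) = \<delta> s * t + s * \<delta> t" for s t
        proof -
          have "sc (\<delta> (s * t)) ?I = D (sc s ?I \<odot> sc t ?I)"
            by (simp add: \<delta>[symmetric] sc_compose)
          also have "\<dots> = sc (\<delta> s * t + s * \<delta> t) ?I"
            using D(3)[OF I(1) I(1)]
            by (simp add: \<delta> sc_compose sc_compose_right bounded_ops_closed operators.scale_left_distrib)
          finally show ?thesis
            by (simp only: I(2))
        qed
        show "algebraic \<xi>"
          using algebraic dim(1) .
      qed
      \<comment> \<open>Now the formula for \<open>D (\<xi> I)\<close> retains only its term with
        \<open>c\<close>.\<close>
      have "D ?I = 0"
        using D(3)[OF dim(2) dim(2)] by simp
      then have "sc ((1 - \<xi>) * c) ?I = 0"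
        using D(4)[OF dim(2)] \<delta>[of \<xi>] \<open>\<delta> \<xi> = 0\<close> by simp
      then show "c = 0"
        using \<xi> dim(3) by simp
    qed
  next
    case 3
    have "S = T" for S T :: "'x \<Rightarrow>\<^sub>L 'x"
      by (rule blinfun_eqI) (metis 3)
    then show ?thesis
      using L' unfolding additive_derivation_def by (auto simp: Pi_iff)
  qed
qed

lemma jordan_derivation_standard_form:
  assumes "additive_xi_Lie_derivation smul (- 1) \<A> L"
  shows "additive_derivation smul \<A> L"
proof -
  have L: "a \<in> \<A> \<Longrightarrow> L a \<in> \<B>" "additive_on \<A> L"
    and jordan: "a \<in> \<A> \<Longrightarrow> b \<in> \<A> \<Longrightarrow>
      L (a \<odot> b + b \<odot> a) = L a \<odot> b + a \<odot> L b + L b \<odot> a + b \<odot> L a" for a b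
    using assms by (auto simp: additive_xi_Lie_derivation_def bracket_def algebra_simps)
  show ?thesis
    using L jordan_derivation_is_derivation[OF L jordan] by (auto simp: additive_derivation_def)
qed

end

section \<open>The three ranges of the parameter \<xi>\<close>

theorem theorem2p3:
  fixes smul :: "'k::real_or_complex \<Rightarrow> 'x::banach \<Rightarrow> 'x"
    and \<A> :: "('x \<Rightarrow>\<^sub>L 'x) set"
    and \<xi> :: 'k
    and L :: "('x \<Rightarrow>\<^sub>L 'x) \<Rightarrow> ('x \<Rightarrow>\<^sub>L 'x)"
  assumes "banach_over smul"
    and "standard_operator_algebra smul \<A>"
    and "\<xi> \<noteq> 0"
    and "additive_xi_Lie_derivation smul \<xi> \<A> L"
  shows
    "(\<xi> = 1 \<and> dim_at_least smul 3 \<longrightarrow>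
       (\<exists>(\<tau> :: ('x \<Rightarrow>\<^sub>L 'x) \<Rightarrow> ('x \<Rightarrow>\<^sub>L 'x)) (h :: ('x \<Rightarrow>\<^sub>L 'x) \<Rightarrow> 'k).
          additive_derivation smul \<A> \<tau> \<and>
          additive_on \<A> h \<and>
          (\<forall>A\<in>\<A>. \<forall>B\<in>\<A>. h (commutator A B) = 0) \<and>
          (\<forall>A\<in>\<A>. L A = \<tau> A + op_scale smul (h A) id_blinfun))) \<and>
     (\<xi> = -1 \<longrightarrow> additive_derivation smul \<A> L) \<and>
     (\<xi> \<noteq> 1 \<and> \<xi> \<noteq> -1 \<and> (vector_space.dim smul UNIV = 1 \<longrightarrow> algebraic \<xi>) \<longrightarrow>
       additive_derivation smul \<A> L \<and>
       (\<forall>A\<in>\<A>. L (op_scale smul \<xi> A) = op_scale smul \<xi> (L A)))"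
proof -
  interpret standard_algebra smul \<A>
    using assms(1,2) by (simp add: standard_algebra_def standard_algebra_axioms_def)
  show ?thesis
  proof (intro conjI impI)
    assume "\<xi> = 1 \<and> dim_at_least smul 3"
    then have dim: "dim_at_least smul 3" and L: "additive_xi_Lie_derivation smul 1 \<A> L"
      using assms(4) by auto
    \<comment> \<open>A spanning singleton would make the space finite-dimensional with
      \<open>dim UNIV \<le> 1\<close>, against both alternatives of
      \<open>dim_at_least\<close>.\<close>
    have proper: "span {x} \<noteq> UNIV" for x
    proof
      assume "span {x} = UNIV"
      then have "dim UNIV \<le> 1" "\<exists>S. finite S \<and> span S = UNIV"
        using dim_le_card[of UNIV "{x}"] by auto
      then show False
        using dim by (auto simp: dim_at_least_def)
    qed
    \<comment> \<open>The span of the zero vector is proper too, so the space is not zero.\<close>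
    have "\<exists>x::'x. x \<noteq> 0"
      using proper[of 0] by (metis UNIV_I UNIV_eq_I span_zero)
    then obtain x :: 'x where "x \<noteq> 0"
      by blast
    then obtain p where "rank_one_peirce smul \<A> p"
      using proper by (rule rank_one_peirce_exists)
    then show "\<exists>\<tau> h. additive_derivation smul \<A> \<tau> \<and> additive_on \<A> h \<and>
        (\<forall>A\<in>\<A>. \<forall>B\<in>\<A>. h (commutator A B) = 0) \<and> (\<forall>A\<in>\<A>. L A = \<tau> A + sc (h A) id_blinfun)"
      using L by (rule lie_derivation_standard_form)
  next
    assume "\<xi> = - 1"
    then show "additive_derivation smul \<A> L"
      using assms(4) by (intro jordan_derivation_standard_form) simp
  next
    assume "\<xi> \<noteq> 1 \<and> \<xi> \<noteq> - 1 \<and> (dim UNIV = 1 \<longrightarrow> algebraic \<xi>)"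
    then have "additive_derivation smul \<A> L \<and> (\<forall>a\<in>\<A>. L (sc \<xi> a) = sc \<xi> (L a))"
      using assms(4) by (intro xi_lie_derivation_is_derivation) auto
    then show "additive_derivation smul \<A> L" "\<forall>a\<in>\<A>. L (sc \<xi> a) = sc \<xi> (L a)"
      by blast+
  qed
qed

end
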